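(* Let $(u,\boldsymbol q)$ be the solution of the model problem, let $(u_h,\boldsymbol q_h)\in\mathcal V_h^{p-1}\times\boldsymbol{\mathcal H}_h^p$ be the solution of the discrete mixed problem (MFEM), and let $(\varepsilon_h,\nu_h)\in\mathcal V_{*,h}^{p+2}\times\mathcal V_h^{p+1}$ be the solution of the local saddle point problems (SP). For $K\in\mathcal T_h$ let $\widetilde\eta_K=\|\nabla\varepsilon_h\|_K$. Then, for all $K\in\mathcal T_h$, $$\widetilde\eta_K\le\|\nabla(u-\nu_h)\|_K+\|\boldsymbol q-\boldsymbol q_h\|_{*,K}.$$
   Context: Let $\Omega\subset\mathbb R^d$ ($d=2,3$) be a polyhedral Lipschitz domain, and $\{\mathcal T_h\}_{h>0}$ a family of conforming, shape-regular simplicial meshes of $\Omega$. For $D\subset\overline\Omega$, $(\cdot,\cdot)_D$ and $\|\cdot\|_D$ are the $L^2(D)$ inner product and norm (scalar or vector-valued functions); $(\cdot,\cdot)_{\mathcal T_h}=\sum_{K\in\mathcal T_h}(\cdot,\cdot)_K$. Fix an integer $p\ge1$, $f\in L^2(\Omega)$ and $u_D\in H^{1/2}(\partial\Omega)$. Spaces: for an integer $r\ge0$, $\mathcal V_K^r$ is the space of polynomials on $K$ of total degree $\le r$; $\mathcal V_{*,K}^r=\{v\in\mathcal V_K^r:(v,1)_K=0\}$; $\mathcal V_h^r$ (resp. $\mathcal V_{*,h}^r$) is the set of $v\in L^2(\Omega)$ with $v|_K\in\mathcal V_K^r$ (resp. $\mathcal V_{*,K}^r$) for all $K\in\mathcal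 T_h$; $\boldsymbol{\mathcal H}_h^r=\{\boldsymbol v\in H(\operatorname{div},\Omega):\boldsymbol v|_K\in(\mathcal V_K^r)^d\ \forall K\in\mathcal T_h\}$. Discrete dual norm: $\displaystyle\|\boldsymbol p\|_{*,K}=\sup_{0\ne v_K\in\mathcal V_{*,K}^{p+2}}\frac{(\boldsymbol p,\nabla v_K)_K}{\|\nabla v_K\|_K}$. Model problem: $u\in H^1(\Omega)$ is the weak solution of $-\Delta u=f$ in $\Omega$, $u=u_D$ on $\partial\Omega$, and $\boldsymbol q=-\nabla u\in H(\operatorname{div},\Omega)$. (MFEM) Find $(u_h,\boldsymbol q_h)\in\mathcal V_h^{p-1}\times\boldsymbol{\mathcal H}_h^p$ such that $(\boldsymbol q_h,\boldsymbol p_h)_{\mathcal T_h}-(\operatorname{div}\boldsymbol p_h,u_h)_{\mathcal T_h}=-\langle u_D,\boldsymbol p_h\cdot\boldsymbol n\rangle_{\partial\Omega}$ for all $\boldsymbol p_h\in\boldsymbol{\mathcal H}_h^p$, and $(\operatorname{div}\boldsymbol q_h,v_h)_{\mathcal T_h}=(f,v_h)_{\mathcal T_h}$ for all $v_h\in\mathcal V_h^{p-1}$. This problem is well-posed. (SP) For each $K\in\mathcal T_h$, $(\varepsilon_K,\nu_K)=(\varepsilon_h|_K,\nu_h|_K)\in\mathcal V_{*,K}^{p+2}\times\mathcal V_K^{p+1}$ satisfies $(\nabla\varepsilon_K,\nabla v_K)_K+(\nabla\nu_K,\nabla v_K)_K=-(\boldsymbol q_h,\nabla v_K)_K$ for all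 $v_K\in\mathcal V_{*,K}^{p+2}$; $(\nabla w_K,\nabla\varepsilon_K)_K=0$ for all $w_K\in\mathcal V_{*,K}^{p+1}$; and $(\nu_K,1)_K=(u_h,1)_K$. *)

theory Defs
  imports "HOL-Analysis.Analysis"
begin

text \<open>Elements of \<open>L\<^sup>2\<close> are represented by functions; functions that agree almost everywhere
  represent the same element. Every notion below respects this identification.\<close>

section \<open>Square-integrable functions\<close>

definition L2 :: "'a measure \<Rightarrow> ('a \<Rightarrow> 'b::euclidean_space) set" where
  "L2 M = {f \<in> borel_measurable M. integrable M (\<lambda>x. (norm (f x))\<^sup>2)}"

definition l2_inner :: "'a measure \<Rightarrow> ('a \<Rightarrow> 'b::euclidean_space) \<Rightarrow> ('a \<Rightarrow> 'b) \<Rightarrow> real" where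
  "l2_inner M f g = (\<integral>x. f x \<bullet> g x \<partial>M)"

definition l2_norm :: "'a measure \<Rightarrow> ('a \<Rightarrow> 'b::euclidean_space) \<Rightarrow> real" where
  "l2_norm M f = sqrt (l2_inner M f f)"

abbreviation L2_on :: "'a::euclidean_space set \<Rightarrow> ('a \<Rightarrow> 'b::euclidean_space) set" where
  "L2_on D \<equiv> L2 (lebesgue_on D)"

abbreviation inner_on ::
    "'a::euclidean_space set \<Rightarrow> ('a \<Rightarrow> 'b::euclidean_space) \<Rightarrow> ('a \<Rightarrow> 'b) \<Rightarrow> real" where
  "inner_on D \<equiv> l2_inner (lebesgue_on D)"

abbreviation norm_on :: "'a::euclidean_space set \<Rightarrow> ('a \<Rightarrow> 'b::euclidean_space) \<Rightarrow> real" where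
  "norm_on D \<equiv> l2_norm (lebesgue_on D)"


section \<open>Weak derivatives\<close>

definition classical_grad :: "(real^'d \<Rightarrow> real) \<Rightarrow> real^'d \<Rightarrow> real^'d" where
  "classical_grad f x = (\<chi> i. frechet_derivative f (at x) (axis i 1))"

primrec Ck :: "nat \<Rightarrow> (real^'d \<Rightarrow> real) \<Rightarrow> bool" where
  "Ck 0 f \<longleftrightarrow> continuous_on UNIV f"
| "Ck (Suc k) f \<longleftrightarrow> (\<forall>x. f differentiable (at x)) \<and> (\<forall>i. Ck k (\<lambda>x. classical_grad f x $ i))"

definition smooth :: "(real^'d \<Rightarrow> real) \<Rightarrow> bool" where
  "smooth f \<longleftrightarrow> (\<forall>k. Ck k f)"

text \<open>The domain \<open>D\<close> below is either an open set or a closed simplex \<open>K\<close>. A Sobolev function on \<open>K\<close>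
  is one on the interior of \<open>K\<close>, which differs from \<open>K\<close> by a null set.\<close>

definition test_functions :: "(real^'d) set \<Rightarrow> (real^'d \<Rightarrow> real) set" where
  "test_functions D =
     {\<phi>. smooth \<phi> \<and> compact (closure {x. \<phi> x \<noteq> 0}) \<and> closure {x. \<phi> x \<noteq> 0} \<subseteq> interior D}"

definition has_weak_grad :: "(real^'d) set \<Rightarrow> (real^'d \<Rightarrow> real) \<Rightarrow> (real^'d \<Rightarrow> real^'d) \<Rightarrow> bool" where
  "has_weak_grad D v g \<longleftrightarrow> v \<in> L2_on D \<and> g \<in> L2_on D \<and>
     (\<forall>\<phi>\<in>test_functions D.
        (\<integral>x. v x *\<^sub>R classical_grad \<phi> x \<partial>lebesgue_on D) = - (\<integral>x. \<phi> x *\<^sub>R g x \<partial>lebesgue_on D))"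

definition H1 :: "(real^'d) set \<Rightarrow> (real^'d \<Rightarrow> real) set" where
  "H1 D = {v. \<exists>g. has_weak_grad D v g}"

text \<open>The weak gradient and the weak divergence are determined up to a null set.\<close>

definition grad :: "(real^'d) set \<Rightarrow> (real^'d \<Rightarrow> real) \<Rightarrow> real^'d \<Rightarrow> real^'d" where
  "grad D v = (SOME g. has_weak_grad D v g)"

definition has_weak_div :: "(real^'d) set \<Rightarrow> (real^'d \<Rightarrow> real^'d) \<Rightarrow> (real^'d \<Rightarrow> real) \<Rightarrow> bool" where
  "has_weak_div D q g \<longleftrightarrow> q \<in> L2_on D \<and> g \<in> L2_on D \<and>
     (\<forall>\<phi>\<in>test_functions D. inner_on D q (classical_grad \<phi>) = - inner_on D g \<phi>)"

definition Hdiv :: "(real^'d) set \<Rightarrow> (real^'d \<Rightarrow> real^'d) set" where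
  "Hdiv D = {q. \<exists>g. has_weak_div D q g}"

definition wdiv :: "(real^'d) set \<Rightarrow> (real^'d \<Rightarrow> real^'d) \<Rightarrow> real^'d \<Rightarrow> real" where
  "wdiv D q = (SOME g. has_weak_div D q g)"


section \<open>Domains and meshes\<close>

text \<open>Near each boundary point, the domain is the part of a ball strictly above the graph, in some
  direction \<open>e\<close>, of a Lipschitz function of the component orthogonal to \<open>e\<close>.\<close>

definition lipschitz_domain :: "(real^'d) set \<Rightarrow> bool" where
  "lipschitz_domain \<Omega> \<longleftrightarrow> open \<Omega> \<and> connected \<Omega> \<and> bounded \<Omega> \<and> \<Omega> \<noteq> {} \<and>
     (\<forall>x\<in>frontier \<Omega>. \<exists>r>0. \<exists>e L. \<exists>\<phi> :: real^'d \<Rightarrow> real. norm e = 1 \<and> lipschitz_on L UNIV \<phi> \<and>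
        \<Omega> \<inter> ball x r = {y \<in> ball x r. \<phi> (y - (y \<bullet> e) *\<^sub>R e) < y \<bullet> e})"

definition polyhedral_lipschitz_domain :: "(real^'d) set \<Rightarrow> bool" where
  "polyhedral_lipschitz_domain \<Omega> \<longleftrightarrow> lipschitz_domain \<Omega> \<and>
     (\<exists>P. finite P \<and> (\<forall>C\<in>P. polytope C) \<and> closure \<Omega> = \<Union>P)"

definition conforming_mesh :: "(real^'d) set \<Rightarrow> (real^'d) set set \<Rightarrow> bool" where
  "conforming_mesh \<Omega> T \<longleftrightarrow>
     triangulation T \<and> (\<forall>K\<in>T. int CARD('d) simplex K) \<and> \<Union>T = closure \<Omega>"

definition inradius :: "(real^'d) set \<Rightarrow> real" where
  "inradius K = Sup {r. 0 \<le> r \<and> (\<exists>x. cball x r \<subseteq> K)}"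

definition shape_regular_mesh_family :: "(real^'d) set \<Rightarrow> (real \<Rightarrow> (real^'d) set set) \<Rightarrow> bool" where
  "shape_regular_mesh_family \<Omega> mesh \<longleftrightarrow>
     (\<forall>h>0. conforming_mesh \<Omega> (mesh h)) \<and>
     (\<exists>\<sigma>>0. \<forall>h>0. \<forall>K\<in>mesh h. diameter K \<le> \<sigma> * inradius K)"


section \<open>Boundary values\<close>

text \<open>Surface measure on the boundary: the Hausdorff measure of dimension \<open>d - 1\<close>, normalised so that
  it is the usual area on hyperplanes.\<close>

definition hausdorff_pre :: "real \<Rightarrow> real \<Rightarrow> 'a::metric_space set \<Rightarrow> ennreal" where
  "hausdorff_pre s \<delta> A =
     (INF C\<in>{C. A \<subseteq> (\<Union>n. C n) \<and> (\<forall>n. bounded (C n) \<and> diameter (C n) \<le> \<delta>)}.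
        \<Sum>n::nat. ennreal (unit_ball_vol s * (diameter (C n) / 2) powr s))"

definition hausdorff_measure :: "real \<Rightarrow> 'a::metric_space measure" where
  "hausdorff_measure s = measure_of UNIV (sets borel) (\<lambda>A. SUP \<delta>\<in>{0<..}. hausdorff_pre s \<delta> A)"

definition surface :: "(real^'d) set \<Rightarrow> (real^'d) measure" where
  "surface \<Omega> = restrict_space (hausdorff_measure (real CARD('d) - 1)) (frontier \<Omega>)"

text \<open>The trace operator is the continuous extension to \<open>H\<^sup>1\<close> of the restriction to the boundary of
  functions that are smooth up to the boundary.\<close>

definition has_trace :: "(real^'d) set \<Rightarrow> (real^'d \<Rightarrow> real) \<Rightarrow> (real^'d \<Rightarrow> real) \<Rightarrow> bool" where
  "has_trace \<Omega> w g \<longleftrightarrow> w \<in> H1 \<Omega> \<and> g \<in> L2 (surface \<Omega>) \<and>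
     (\<exists>\<psi>. (\<forall>n. smooth (\<psi> n)) \<and>
        (\<lambda>n. norm_on \<Omega> (\<lambda>x. \<psi> n x - w x)) \<longlonglongrightarrow> 0 \<and>
        (\<lambda>n. norm_on \<Omega> (\<lambda>x. classical_grad (\<psi> n) x - grad \<Omega> w x)) \<longlonglongrightarrow> 0 \<and>
        (\<lambda>n. l2_norm (surface \<Omega>) (\<lambda>x. \<psi> n x - g x)) \<longlonglongrightarrow> 0)"

definition H1_0 :: "(real^'d) set \<Rightarrow> (real^'d \<Rightarrow> real) set" where
  "H1_0 \<Omega> = {w. has_trace \<Omega> w (\<lambda>x. 0)}"

text \<open>\<open>H\<^sup>1\<^sup>/\<^sup>2(\<partial>\<Omega>)\<close> is the trace space of \<open>H\<^sup>1(\<Omega>)\<close>.\<close>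

definition H_half :: "(real^'d) set \<Rightarrow> (real^'d \<Rightarrow> real) set" where
  "H_half \<Omega> = {g. \<exists>w. has_trace \<Omega> w g}"

text \<open>The normal trace of \<open>q \<in> H(div, \<Omega>)\<close> is the functional on \<open>H\<^sup>1\<^sup>/\<^sup>2(\<partial>\<Omega>)\<close> given by Green's formula;
  the value does not depend on the chosen lifting \<open>w\<close> of \<open>g\<close>.\<close>

definition boundary_pairing :: "(real^'d) set \<Rightarrow> (real^'d \<Rightarrow> real) \<Rightarrow> (real^'d \<Rightarrow> real^'d) \<Rightarrow> real" where
  "boundary_pairing \<Omega> g q =
     (let w = (SOME w. has_trace \<Omega> w g) in inner_on \<Omega> q (grad \<Omega> w) + inner_on \<Omega> (wdiv \<Omega> q) w)"


section \<open>Model problem\<close>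

definition model_solution ::
    "(real^'d) set \<Rightarrow> (real^'d \<Rightarrow> real) \<Rightarrow> (real^'d \<Rightarrow> real) \<Rightarrow>
     (real^'d \<Rightarrow> real) \<Rightarrow> (real^'d \<Rightarrow> real^'d) \<Rightarrow> bool" where
  "model_solution \<Omega> f u\<^sub>D u q \<longleftrightarrow>
     u \<in> H1 \<Omega> \<and> has_trace \<Omega> u u\<^sub>D \<and>
     (\<forall>v\<in>H1_0 \<Omega>. inner_on \<Omega> (grad \<Omega> u) (grad \<Omega> v) = inner_on \<Omega> f v) \<and>
     q \<in> Hdiv \<Omega> \<and> (AE x in lebesgue_on \<Omega>. q x = - grad \<Omega> u x)"


section \<open>Discrete spaces and discrete problems\<close>

definition polys :: "nat \<Rightarrow> (real^'d \<Rightarrow> real) set" where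
  "polys r = {P. \<exists>c. \<forall>x. P x = (\<Sum>\<alpha>\<in>{\<alpha> :: 'd \<Rightarrow> nat. sum \<alpha> UNIV \<le> r}. c \<alpha> * (\<Prod>i\<in>UNIV. x $ i ^ \<alpha> i))}"

definition V_loc :: "(real^'d) set \<Rightarrow> nat \<Rightarrow> (real^'d \<Rightarrow> real) set" where
  "V_loc K r = {v. \<exists>P\<in>polys r. AE x in lebesgue_on K. v x = P x}"

definition V_star_loc :: "(real^'d) set \<Rightarrow> nat \<Rightarrow> (real^'d \<Rightarrow> real) set" where
  "V_star_loc K r = {v \<in> V_loc K r. inner_on K v (\<lambda>x. 1) = 0}"

definition V_mesh :: "(real^'d) set \<Rightarrow> (real^'d) set set \<Rightarrow> nat \<Rightarrow> (real^'d \<Rightarrow> real) set" where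
  "V_mesh \<Omega> T r = {v \<in> L2_on \<Omega>. \<forall>K\<in>T. v \<in> V_loc K r}"

definition V_star_mesh :: "(real^'d) set \<Rightarrow> (real^'d) set set \<Rightarrow> nat \<Rightarrow> (real^'d \<Rightarrow> real) set" where
  "V_star_mesh \<Omega> T r = {v \<in> L2_on \<Omega>. \<forall>K\<in>T. v \<in> V_star_loc K r}"

definition H_mesh :: "(real^'d) set \<Rightarrow> (real^'d) set set \<Rightarrow> nat \<Rightarrow> (real^'d \<Rightarrow> real^'d) set" where
  "H_mesh \<Omega> T r = {q \<in> Hdiv \<Omega>. \<forall>K\<in>T. \<forall>i. (\<lambda>x. q x $ i) \<in> V_loc K r}"

definition inner_mesh ::
    "(real^'d) set set \<Rightarrow> (real^'d \<Rightarrow> 'b::euclidean_space) \<Rightarrow> (real^'d \<Rightarrow> 'b) \<Rightarrow> real" where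
  "inner_mesh T f g = (\<Sum>K\<in>T. inner_on K f g)"

definition dual_norm :: "nat \<Rightarrow> (real^'d) set \<Rightarrow> (real^'d \<Rightarrow> real^'d) \<Rightarrow> real" where
  "dual_norm p K q =
     Sup {inner_on K q (grad K v) / norm_on K (grad K v) | v.
            v \<in> V_star_loc K (p + 2) \<and> \<not> (AE x in lebesgue_on K. v x = 0)}"

definition mfem_solution ::
    "(real^'d) set \<Rightarrow> (real^'d) set set \<Rightarrow> nat \<Rightarrow> (real^'d \<Rightarrow> real) \<Rightarrow> (real^'d \<Rightarrow> real) \<Rightarrow>
     (real^'d \<Rightarrow> real) \<Rightarrow> (real^'d \<Rightarrow> real^'d) \<Rightarrow> bool" where
  "mfem_solution \<Omega> T p f u\<^sub>D u\<^sub>h q\<^sub>h \<longleftrightarrow>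
     u\<^sub>h \<in> V_mesh \<Omega> T (p - 1) \<and> q\<^sub>h \<in> H_mesh \<Omega> T p \<and>
     (\<forall>p\<^sub>h\<in>H_mesh \<Omega> T p.
        inner_mesh T q\<^sub>h p\<^sub>h - inner_mesh T (wdiv \<Omega> p\<^sub>h) u\<^sub>h = - boundary_pairing \<Omega> u\<^sub>D p\<^sub>h) \<and>
     (\<forall>v\<^sub>h\<in>V_mesh \<Omega> T (p - 1). inner_mesh T (wdiv \<Omega> q\<^sub>h) v\<^sub>h = inner_mesh T f v\<^sub>h)"

definition sp_solution ::
    "(real^'d) set \<Rightarrow> (real^'d) set set \<Rightarrow> nat \<Rightarrow> (real^'d \<Rightarrow> real) \<Rightarrow> (real^'d \<Rightarrow> real^'d) \<Rightarrow>
     (real^'d \<Rightarrow> real) \<Rightarrow> (real^'d \<Rightarrow> real) \<Rightarrow> bool" where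
  "sp_solution \<Omega> T p u\<^sub>h q\<^sub>h \<epsilon>\<^sub>h \<nu>\<^sub>h \<longleftrightarrow>
     \<epsilon>\<^sub>h \<in> V_star_mesh \<Omega> T (p + 2) \<and> \<nu>\<^sub>h \<in> V_mesh \<Omega> T (p + 1) \<and>
     (\<forall>K\<in>T.
        (\<forall>v\<in>V_star_loc K (p + 2).
           inner_on K (grad K \<epsilon>\<^sub>h) (grad K v) + inner_on K (grad K \<nu>\<^sub>h) (grad K v)
             = - inner_on K q\<^sub>h (grad K v)) \<and>
        (\<forall>w\<in>V_star_loc K (p + 1). inner_on K (grad K w) (grad K \<epsilon>\<^sub>h) = 0) \<and>
        inner_on K \<nu>\<^sub>h (\<lambda>x. 1) = inner_on K u\<^sub>h (\<lambda>x. 1))"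

definition estimator :: "(real^'d) set \<Rightarrow> (real^'d \<Rightarrow> real) \<Rightarrow> real" where
  "estimator K \<epsilon>\<^sub>h = norm_on K (grad K \<epsilon>\<^sub>h)"

end

theory Submission
  imports Defs "HOL-Real_Asymp.Real_Asymp"
begin

text \<open>Testing the saddle point problem with \<open>v = \<epsilon>\<^sub>h\<close> and using \<open>q = - \<nabla>u\<close> gives
  \<open>\<parallel>\<nabla>\<epsilon>\<^sub>h\<parallel>\<^sup>2 = (\<nabla>(u - \<nu>\<^sub>h), \<nabla>\<epsilon>\<^sub>h) + (q - q\<^sub>h, \<nabla>\<epsilon>\<^sub>h)\<close> on each \<open>K\<close>; Cauchy-Schwarz and
  the definition of the dual norm bound the two terms. Since \<open>grad\<close> is a choice of weak gradient,
  these manipulations need the weak gradient to be unique up to null sets, to exist for piecewise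
  polynomials, and to restrict from \<open>\<Omega>\<close> to \<open>K\<close>.\<close>

section \<open>Smooth functions and bump functions\<close>

text \<open>The data \<open>u\<close>, \<open>q\<close> live on \<Omega>, the estimate on a closed
  element \<open>K\<close>. A test function on \<open>K\<close> is one on \<Omega> only if
  \<open>interior K\<close> lies in \<Omega>, whereas the mesh gives only that \<open>K\<close> lies
  in \<open>closure \<Omega>\<close>. For a slit disc an element may cross the slit, and
  \<open>u\<close> may jump inside it. The Lipschitz graph condition excludes this: it forces
  \<open>interior (closure \<Omega>) = \<Omega>\<close>. Test functions see only
  \<open>interior K\<close>, so statements almost everywhere on \<open>K\<close> also need
  \<open>K - interior K\<close> to be null, which follows from convexity. The second obstacle is
  \<open>dual_norm\<close>, a supremum in the reals: it is an upper bound only once Cauchy-Schwarz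
  has bounded the quotients. The testing argument ends in N * N \<le> (a + b) * N; cancelling
  \<open>N\<close> leaves the case N = 0, where the dual norm itself must be known to be
  nonnegative.\<close>

lemma classical_grad_nth:
  assumes "(f has_derivative f') (at x)"
  shows "classical_grad f x $ i = f' (axis i 1)"
  using frechet_derivative_at[OF assms] by (simp add: classical_grad_def)

text \<open>Replaces the chosen \<open>frechet_derivative\<close> by an explicit derivative, so that
  each closure property of \<open>Ck\<close> becomes an induction on \<open>k\<close>.\<close>

lemma has_derivative_imp_Ck_Suc:
  assumes "\<And>x. (f has_derivative f' x) (at x)"
    and "\<And>i. Ck k (\<lambda>x. f' x (axis i 1))"
  shows "Ck (Suc k) f"
proof -
  have "(\<lambda>x. classical_grad f x $ i) = (\<lambda>x. f' x (axis i 1))" for i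
    using classical_grad_nth[OF assms(1)] by blast
  then show ?thesis
    using assms by (auto simp: differentiable_def)
qed

text \<open>The recursion speaks of the derivatives only, so lowering the order takes an induction
  down to "differentiable implies continuous". The product rule relies on it, since one factor
  always stays undifferentiated.\<close>

lemma Ck_SucD: "Ck (Suc k) f \<Longrightarrow> Ck k f"
proof (induction k arbitrary: f)
  case 0
  then show ?case
    by (simp add: differentiable_imp_continuous_on differentiable_on_def)
next
  case (Suc k)
  show ?case
    unfolding Ck.simps(2)[of k]
  proof (intro conjI allI)
    show "f differentiable at x" for x
      using Suc.prems by simp
    show "Ck k (\<lambda>x. classical_grad f x $ i)" for i
    proof (rule Suc.IH)
      show "Ck (Suc k) (\<lambda>x. classical_grad f x $ i)"
        using Suc.prems unfolding Ck.simps(2)[of "Suc k"] by blast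
    qed
  qed
qed

lemma Ck_has_derivative:
  assumes "Ck (Suc k) f"
  shows "(f has_derivative frechet_derivative f (at x)) (at x)"
    and "Ck k (\<lambda>x. frechet_derivative f (at x) (axis i 1))"
  using assms frechet_derivative_works by (auto simp: classical_grad_def)

lemma Ck_const: "Ck k (\<lambda>x. c)"
proof (induction k arbitrary: c)
  case (Suc k)
  show ?case
    by (rule has_derivative_imp_Ck_Suc[where f' = "\<lambda>x h. 0"]) (auto intro: Suc)
qed simp

lemma Ck_add: "Ck k f \<Longrightarrow> Ck k g \<Longrightarrow> Ck k (\<lambda>x. f x + g x)"
proof (induction k arbitrary: f g)
  case 0
  then show ?case by (simp add: continuous_on_add)
next
  case (Suc k)
  show ?case
    by (rule has_derivative_imp_Ck_Suc[where
          f' = "\<lambda>x h. frechet_derivative f (at x) h + frechet_derivative g (at x) h"])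
      (intro has_derivative_add Suc.IH Ck_has_derivative[OF Suc.prems(1)] Ck_has_derivative[OF Suc.prems(2)])+
qed

lemma Ck_mult: "Ck k f \<Longrightarrow> Ck k g \<Longrightarrow> Ck k (\<lambda>x. f x * g x)"
proof (induction k arbitrary: f g)
  case 0
  then show ?case by (simp add: continuous_on_mult)
next
  case (Suc k)
  show ?case
    by (rule has_derivative_imp_Ck_Suc[where
          f' = "\<lambda>x h. f x * frechet_derivative g (at x) h + frechet_derivative f (at x) h * g x"])
      (intro has_derivative_mult Ck_add Suc.IH Ck_SucD[OF Suc.prems(1)] Ck_SucD[OF Suc.prems(2)]
        Ck_has_derivative[OF Suc.prems(1)] Ck_has_derivative[OF Suc.prems(2)])+
qed

lemma Ck_sum: "(\<And>i. i \<in> I \<Longrightarrow> Ck k (f i)) \<Longrightarrow> Ck k (\<lambda>x. \<Sum>i\<in>I. f i x)"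
  by (induction I rule: infinite_finite_induct) (auto intro: Ck_const Ck_add)

lemma Ck_prod: "(\<And>i. i \<in> I \<Longrightarrow> Ck k (f i)) \<Longrightarrow> Ck k (\<lambda>x. \<Prod>i\<in>I. f i x)"
  by (induction I rule: infinite_finite_induct) (auto intro: Ck_const Ck_mult)

lemma Ck_coord: "Ck k (\<lambda>x. x $ i)"
proof (cases k)
  case 0
  then show ?thesis by (simp add: continuous_on_component)
next
  case (Suc m)
  have "Ck (Suc m) (\<lambda>x :: real^'a. x $ i)"
    by (rule has_derivative_imp_Ck_Suc[where f' = "\<lambda>x h. h $ i"])
      (auto intro: Ck_const bounded_linear_imp_has_derivative bounded_linear_vec_nth)
  then show ?thesis by (simp add: Suc)
qed

lemma Ck_power: "Ck k f \<Longrightarrow> Ck k (\<lambda>x. f x ^ n)"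
  by (induction n) (auto intro: Ck_const Ck_mult)

lemma Ck_polys: "P \<in> polys r \<Longrightarrow> Ck k P"
proof -
  assume "P \<in> polys r"
  then obtain c where "P = (\<lambda>x. \<Sum>\<alpha>\<in>{\<alpha> :: 'a \<Rightarrow> nat. sum \<alpha> UNIV \<le> r}. c \<alpha> * (\<Prod>i\<in>UNIV. x $ i ^ \<alpha> i))"
    unfolding polys_def by blast
  then show ?thesis
    by (auto intro!: Ck_sum Ck_mult Ck_const Ck_prod Ck_power Ck_coord)
qed

lemma continuous_on_classical_grad: "Ck (Suc 0) f \<Longrightarrow> continuous_on S (classical_grad f)"
proof (rule continuous_on_subset[OF _ subset_UNIV])
  assume "Ck (Suc 0) f"
  then show "continuous_on UNIV (classical_grad f)"
    by (subst continuous_on_componentwise) (auto simp: Basis_vec_def inner_axis)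
qed

lemma classical_grad_mult:
  assumes "f differentiable at x" "g differentiable at x"
  shows "classical_grad (\<lambda>x. f x * g x) x = f x *\<^sub>R classical_grad g x + g x *\<^sub>R classical_grad f x"
proof (rule vec_eq_iff[THEN iffD2], rule allI)
  fix i
  have "((\<lambda>x. f x * g x) has_derivative
      (\<lambda>h. f x * frechet_derivative g (at x) h + frechet_derivative f (at x) h * g x)) (at x)"
    using assms by (intro has_derivative_mult) (simp_all add: frechet_derivative_works)
  from classical_grad_nth[OF this]
  show "classical_grad (\<lambda>x. f x * g x) x $ i =
      (f x *\<^sub>R classical_grad g x + g x *\<^sub>R classical_grad f x) $ i"
    by (simp add: classical_grad_def)
qed

lemma classical_grad_eq_0:
  assumes "x \<notin> closure {x. f x \<noteq> 0}"
  shows "classical_grad f x = 0"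
proof -
  have "(f has_derivative (\<lambda>h. 0)) (at x)"
  proof (rule has_derivative_transform_within_open[of "\<lambda>x. 0"])
    show "open (- closure {x. f x \<noteq> 0})" by (rule open_Compl) (rule closed_closure)
    show "x \<in> - closure {x. f x \<noteq> 0}" using assms by simp
    show "0 = f y" if "y \<in> - closure {x. f x \<noteq> 0}" for y
      using that closure_subset[of "{x. f x \<noteq> 0}"] by auto
  qed simp
  from classical_grad_nth[OF this] show ?thesis by (simp add: vec_eq_iff)
qed

text \<open>For \<open>m = 0\<close> this is the flat function exp(-1/t). The extra powers of 1/t
  make the family closed, up to linear combinations, under differentiation, so smoothness of all
  members follows from one induction with \<open>m\<close> arbitrary.\<close>

definition exp_recip :: "nat \<Rightarrow> real \<Rightarrow> real" where
  "exp_recip m t = (if t \<le> 0 then 0 else exp (- inverse t) * inverse t ^ m)"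

lemma exp_recip_deriv:
  "(exp_recip m has_real_derivative (exp_recip (m + 2) t - m * exp_recip (m + 1) t)) (at t)"
proof -
  consider "t < 0" | "t = 0" | "t > 0" by linarith
  then show ?thesis
  proof cases
    case 1
    then have "((\<lambda>t. 0) has_real_derivative (exp_recip (m + 2) t - m * exp_recip (m + 1) t)) (at t)"
      by (simp add: exp_recip_def)
    then show ?thesis
      by (rule has_field_derivative_transform_within_open[where S = "{..<0}"])
        (use 1 in \<open>auto simp: exp_recip_def\<close>)
  next
    case 3
    \<comment> \<open>The power rule produces the truncated exponent \<open>m - 1\<close>; for
      \<open>m = 0\<close> the factor \<open>real m\<close> removes the term.\<close>
    have eq: "real m * inverse t ^ (m - 1) * inverse t ^ 2 = real m * inverse t ^ (m + 1)"
      by (cases m) (simp_all add: power2_eq_square)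
    have "((\<lambda>t. exp (- inverse t) * inverse t ^ m) has_real_derivative
        exp (- inverse t) * inverse t ^ 2 * inverse t ^ m
          - exp (- inverse t) * (real m * inverse t ^ (m - 1) * inverse t ^ 2)) (at t)"
      using 3 by (auto intro!: derivative_eq_intros simp: power2_eq_square)
    then have "((\<lambda>t. exp (- inverse t) * inverse t ^ m) has_real_derivative
        (exp_recip (m + 2) t - m * exp_recip (m + 1) t)) (at t)"
      unfolding eq using 3 by (simp add: exp_recip_def power_add power2_eq_square mult_ac)
    then show ?thesis
      by (rule has_field_derivative_transform_within_open[where S = "{0<..}"])
        (use 3 in \<open>auto simp: exp_recip_def\<close>)
  next
    case 2
    \<comment> \<open>At 0 the function and the claimed derivative both vanish. The quotient is zero
      on the left, and on the right exp(-1/h) decays faster than any power of 1/h grows.\<close>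
    have "((\<lambda>h. exp_recip m h / h) \<longlongrightarrow> 0) (at 0)"
    proof (rule filterlim_split_at_real)
      have "((\<lambda>h::real. 0::real) \<longlongrightarrow> 0) (at_left 0)" by simp
      then show "((\<lambda>h. exp_recip m h / h) \<longlongrightarrow> 0) (at_left 0)"
        by (rule Lim_transform_eventually)
          (auto simp: eventually_at_filter exp_recip_def)
      have "((\<lambda>h::real. exp (- inverse h) * inverse h ^ m / h) \<longlongrightarrow> 0) (at_right 0)"
        by real_asymp
      then show "((\<lambda>h. exp_recip m h / h) \<longlongrightarrow> 0) (at_right 0)"
        by (rule Lim_transform_eventually)
          (auto simp: eventually_at_filter exp_recip_def)
    qed
    then show ?thesis
      by (simp add: 2 DERIV_def exp_recip_def)
  qed
qed

lemma Ck_exp_recip_affine: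
  fixes i :: "'d::finite"
  shows "Ck k (\<lambda>x :: real^'d. exp_recip m (c * x $ i + b))"
proof (induction k arbitrary: m)
  case 0
  have "continuous_on UNIV (exp_recip m)"
    by (rule DERIV_continuous_on) (rule has_field_derivative_at_within[OF exp_recip_deriv])
  then have "continuous_on UNIV (\<lambda>x :: real^'d. exp_recip m (c * x $ i + b))"
    by (rule continuous_on_compose2) (auto intro!: continuous_intros)
  then show ?case by simp
next
  case (Suc k)
  define D where "D x = exp_recip (m + 2) (c * x $ i + b) + - m * exp_recip (m + 1) (c * x $ i + b)"
    for x :: "real^'d"
  show ?case
  proof (rule has_derivative_imp_Ck_Suc[where f' = "\<lambda>x h. D x * (c * h $ i)"])
    fix x :: "real^'d"
    have "((\<lambda>x. c * x $ i + b) has_derivative (\<lambda>h. c * h $ i)) (at x)"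
      by (auto intro!: derivative_eq_intros bounded_linear_imp_has_derivative bounded_linear_vec_nth)
    moreover have "(exp_recip m has_derivative (*) (D x)) (at (c * x $ i + b))"
      using exp_recip_deriv[of m "c * x $ i + b"] by (simp add: has_field_derivative_def D_def)
    ultimately show "((\<lambda>x. exp_recip m (c * x $ i + b)) has_derivative (\<lambda>h. D x * (c * h $ i))) (at x)"
      by (rule has_derivative_compose)
  next
    show "Ck k (\<lambda>x. D x * (c * axis j 1 $ i))" for j
      unfolding D_def by (intro Ck_mult Ck_add Ck_const Suc)
  qed
qed

text \<open>Each factor is \<open>exp (- 1 / (n s))\<close>, the \<open>n\<close>-th root of a fixed bump, so that the limit in \<open>n\<close> is
  an indicator function.\<close>

definition box_bump :: "real^'d \<Rightarrow> real^'d \<Rightarrow> nat \<Rightarrow> real^'d \<Rightarrow> real" where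
  "box_bump a b n x = (\<Prod>i\<in>UNIV. exp_recip 0 (real n * x $ i + - (real n * a $ i)) * exp_recip 0 (- real n * x $ i + real n * b $ i))"

lemma smooth_box_bump: "smooth (box_bump a b n)"
  unfolding smooth_def box_bump_def by (intro allI Ck_prod Ck_mult Ck_exp_recip_affine)

lemma exp_recip_0_bounds: "0 \<le> exp_recip 0 t" "exp_recip 0 t \<le> 1"
  by (auto simp: exp_recip_def)

lemma box_bump_bounds: "0 \<le> box_bump a b n x" "box_bump a b n x \<le> 1"
  unfolding box_bump_def
  by (auto intro!: prod_nonneg prod_le_1 mult_nonneg_nonneg mult_le_one exp_recip_0_bounds)

lemma box_bump_eq_0:
  assumes "x \<notin> box a b"
  shows "box_bump a b n x = 0"
proof -
  from assms obtain i where "x $ i \<le> a $ i \<or> b $ i \<le> x $ i"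
    by (auto simp: mem_box_cart not_less)
  then have "real n * x $ i + - (real n * a $ i) \<le> 0 \<or> - real n * x $ i + real n * b $ i \<le> 0"
    by (auto intro: mult_left_mono)
  then have "exp_recip 0 (real n * x $ i + - (real n * a $ i)) * exp_recip 0 (- real n * x $ i + real n * b $ i) = 0"
    by (auto simp: exp_recip_def)
  then show ?thesis
    unfolding box_bump_def by (intro prod_zero) auto
qed

lemma box_bump_tendsto: "(\<lambda>n. box_bump a b n x) \<longlonglongrightarrow> indicator (box a b) x"
proof (cases "x \<in> box a b")
  case False
  then show ?thesis by (simp add: box_bump_eq_0)
next
  case True
  have *: "(\<lambda>n. exp_recip 0 (real n * s)) \<longlonglongrightarrow> 1" if "s > 0" for s
  proof -
    have "(\<lambda>n. exp (- inverse (real n * s))) \<longlonglongrightarrow> 1"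
      using that by real_asymp
    then show ?thesis
      by (rule Lim_transform_eventually)
        (use that in \<open>auto simp: exp_recip_def mult_le_0_iff intro!: eventually_mono[OF eventually_gt_at_top[of 0]]\<close>)
  qed
  have "(\<lambda>n. \<Prod>i\<in>UNIV. exp_recip 0 (real n * (x $ i - a $ i)) * exp_recip 0 (real n * (b $ i - x $ i)))
      \<longlonglongrightarrow> (\<Prod>i\<in>(UNIV::'a set). 1 * 1)"
    using True by (intro tendsto_prod tendsto_mult *) (auto simp: mem_box_cart)
  then show ?thesis
    using True by (simp add: box_bump_def algebra_simps)
qed

lemma box_bump_test_function:
  assumes "cbox a b \<subseteq> interior D"
  shows "box_bump a b n \<in> test_functions D"
proof -
  have "closure {x. box_bump a b n x \<noteq> 0} \<subseteq> cbox a b"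
  proof (rule closure_minimal)
    show "{x. box_bump a b n x \<noteq> 0} \<subseteq> cbox a b"
      using box_bump_eq_0 box_subset_cbox[of a b] by blast
  qed (rule closed_cbox)
  moreover from this have "compact (closure {x. box_bump a b n x \<noteq> 0})"
    by (meson bounded_cbox bounded_subset closed_closure compact_eq_bounded_closed)
  ultimately show ?thesis
    using assms smooth_box_bump by (auto simp: test_functions_def)
qed

section \<open>Square-integrable functions\<close>

lemma L2_measurable: "f \<in> L2 M \<Longrightarrow> f \<in> borel_measurable M"
  by (simp add: L2_def)

lemma L2_integrable: "f \<in> L2 M \<Longrightarrow> integrable M (\<lambda>x. (norm (f x))\<^sup>2)"
  by (simp add: L2_def)

text \<open>Dominated by the sum of the squared norms, through 2ab \<le> a^2 + b^2. Only a norm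
  bound is assumed of \<open>b\<close>, hence the separate measurability hypothesis;
  \<open>scaleR\<close> and \<open>inner\<close> are the two uses.\<close>

lemma integrable_L2_bilinear:
  fixes b :: "'a::euclidean_space \<Rightarrow> 'b::euclidean_space \<Rightarrow> 'c::{banach, second_countable_topology}"
  assumes f: "f \<in> L2 M" and g: "g \<in> L2 M"
    and b: "(\<lambda>x. b (f x) (g x)) \<in> borel_measurable M"
    and le: "\<And>u v. norm (b u v) \<le> norm u * norm v"
  shows "integrable M (\<lambda>x. b (f x) (g x))"
proof (rule Bochner_Integration.integrable_bound)
  show "integrable M (\<lambda>x. (norm (f x))\<^sup>2 + (norm (g x))\<^sup>2)"
    using L2_integrable[OF f] L2_integrable[OF g] by simp
  have "norm (b u v) \<le> norm ((norm u)\<^sup>2 + (norm v)\<^sup>2)" for u v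
  proof -
    have "2 * (norm u * norm v) \<le> (norm u)\<^sup>2 + (norm v)\<^sup>2"
      using sum_squares_bound[of "norm u" "norm v"] by simp
    moreover have "0 \<le> norm u * norm v" by simp
    ultimately have "norm (b u v) \<le> (norm u)\<^sup>2 + (norm v)\<^sup>2"
      using le[of u v] by linarith
    then show ?thesis by simp
  qed
  then show "AE x in M. norm (b (f x) (g x)) \<le> norm ((norm (f x))\<^sup>2 + (norm (g x))\<^sup>2)"
    by simp
qed (fact b)

lemma integrable_L2_scaleR:
  "f \<in> L2 M \<Longrightarrow> g \<in> L2 M \<Longrightarrow> integrable M (\<lambda>x. f x *\<^sub>R g x)"
  by (rule integrable_L2_bilinear[where b = scaleR])
    (simp_all add: borel_measurable_scaleR[OF L2_measurable L2_measurable])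

lemma integrable_L2_inner:
  "f \<in> L2 M \<Longrightarrow> g \<in> L2 M \<Longrightarrow> integrable M (\<lambda>x. f x \<bullet> g x)"
  by (rule integrable_L2_bilinear[where b = inner])
    (simp_all add: borel_measurable_inner[OF L2_measurable L2_measurable] Cauchy_Schwarz_ineq2)

lemma L2_scaleR: "f \<in> L2 M \<Longrightarrow> (\<lambda>x. c *\<^sub>R f x) \<in> L2 M"
  by (auto simp: L2_def power_mult_distrib)

lemma L2_add:
  assumes "f \<in> L2 M" "g \<in> L2 M"
  shows "(\<lambda>x. f x + g x) \<in> L2 M"
proof -
  have "integrable M (\<lambda>x. f x \<bullet> f x + 2 * (f x \<bullet> g x) + g x \<bullet> g x)"
    using assms by (intro Bochner_Integration.integrable_add integrable_mult_right integrable_L2_inner)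
  then show ?thesis
    using assms by (auto simp: L2_def power2_norm_eq_inner inner_add inner_commute algebra_simps)
qed

lemma L2_diff: "f \<in> L2 M \<Longrightarrow> g \<in> L2 M \<Longrightarrow> (\<lambda>x. f x - g x) \<in> L2 M"
  using L2_add[of f M "\<lambda>x. (- 1) *\<^sub>R g x"] L2_scaleR[of g M "- 1"] by simp

lemma l2_inner_diff_left:
  "f \<in> L2 M \<Longrightarrow> g \<in> L2 M \<Longrightarrow> k \<in> L2 M \<Longrightarrow>
    l2_inner M (\<lambda>x. f x - g x) k = l2_inner M f k - l2_inner M g k"
  unfolding l2_inner_def by (simp add: inner_diff_left integrable_L2_inner)

lemma l2_inner_scaleR_left: "l2_inner M (\<lambda>x. c *\<^sub>R f x) g = c * l2_inner M f g"
  unfolding l2_inner_def by simp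

lemma l2_inner_commute: "l2_inner M f g = l2_inner M g f"
  unfolding l2_inner_def by (simp add: inner_commute)

lemma l2_inner_self_nonneg: "0 \<le> l2_inner M f f"
  unfolding l2_inner_def by simp

lemma l2_norm_nonneg: "0 \<le> l2_norm M f"
  by (simp add: l2_norm_def l2_inner_self_nonneg)

lemma l2_norm_sq: "l2_norm M f * l2_norm M f = l2_inner M f f"
  by (simp add: l2_norm_def l2_inner_self_nonneg)

lemma l2_inner_cong_AE:
  assumes "f \<in> L2 M" "g \<in> L2 M" "f' \<in> L2 M" "g' \<in> L2 M"
    and "AE x in M. f x = f' x" "AE x in M. g x = g' x"
  shows "l2_inner M f g = l2_inner M f' g'"
  unfolding l2_inner_def
proof (rule integral_cong_AE)
  show "AE x in M. f x \<bullet> g x = f' x \<bullet> g' x"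
    using assms(5,6) by eventually_elim simp
qed (use assms in \<open>simp_all add: borel_measurable_inner[OF L2_measurable L2_measurable]\<close>)

text \<open>Discriminant argument: the squared norm of \<open>f - t g\<close> is a nonnegative
  quadratic in \<open>t\<close>.\<close>

lemma l2_cauchy_schwarz:
  assumes f: "f \<in> L2 M" and g: "g \<in> L2 M"
  shows "\<bar>l2_inner M f g\<bar> \<le> l2_norm M f * l2_norm M g"
proof -
  define A B C where "A = l2_inner M f f" and "B = l2_inner M g g" and "C = l2_inner M f g"
  have quad: "0 \<le> A - 2 * t * C + t\<^sup>2 * B" for t
  proof -
    have tg: "(\<lambda>x. t *\<^sub>R g x) \<in> L2 M" by (rule L2_scaleR[OF g])
    have "0 \<le> l2_inner M (\<lambda>x. f x - t *\<^sub>R g x) (\<lambda>x. f x - t *\<^sub>R g x)"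
      by (rule l2_inner_self_nonneg)
    also have "\<dots> = A - 2 * t * C + t\<^sup>2 * B"
      by (simp add: A_def B_def C_def l2_inner_diff_left[OF f tg L2_diff[OF f tg]]
          l2_inner_scaleR_left l2_inner_commute[of M _ "\<lambda>x. f x - t *\<^sub>R g x"]
          l2_inner_diff_left[OF f tg f] l2_inner_diff_left[OF f tg g] l2_inner_commute[of M g f]
          power2_eq_square algebra_simps)
    finally show ?thesis .
  qed
  have "B \<ge> 0" unfolding B_def by (rule l2_inner_self_nonneg)
  have "C\<^sup>2 \<le> A * B"
  proof (cases "B = 0")
    case True
    have "C = 0"
    proof (rule ccontr)
      assume "C \<noteq> 0"
      \<comment> \<open>With \<open>B = 0\<close> the quadratic is affine in \<open>t\<close>, and
        this \<open>t\<close> gives it the value -1.\<close>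
      then show False
        using quad[of "(A + 1) / (2 * C)"] True by simp
    qed
    then show ?thesis by (simp add: True)
  next
    case False
    \<comment> \<open>\<open>C / B\<close> is the minimizer of the quadratic.\<close>
    then have "0 \<le> (A * B - C\<^sup>2) / B"
      using quad[of "C / B"] by (simp add: field_simps power2_eq_square)
    then show ?thesis
      using False \<open>B \<ge> 0\<close> by (simp add: zero_le_divide_iff)
  qed
  then have "sqrt (C\<^sup>2) \<le> sqrt (A * B)" by (rule real_sqrt_le_mono)
  then show ?thesis
    by (simp add: A_def B_def C_def l2_norm_def real_sqrt_mult)
qed

text \<open>Rests on completeness of Lebesgue measure. Extension by zero moves the claim to the
  whole space, where a change on a null set keeps measurability.\<close>

lemma borel_measurable_lebesgue_on_AE:
  fixes f g :: "'a::euclidean_space \<Rightarrow> 'b::euclidean_space"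
  assumes f: "f \<in> borel_measurable (lebesgue_on S)" and S: "S \<in> sets lebesgue"
    and eq: "AE x in lebesgue_on S. f x = g x"
  shows "g \<in> borel_measurable (lebesgue_on S)"
proof -
  have S': "S \<inter> space lebesgue \<in> sets lebesgue" using S by simp
  have "AE x in lebesgue. x \<in> S \<longrightarrow> f x = g x"
    using eq by (simp only: AE_restrict_space_iff[OF S'])
  then have "AE x in lebesgue. indicator S x *\<^sub>R f x = indicator S x *\<^sub>R g x"
    by eventually_elim (auto simp: indicator_def)
  then show ?thesis
    using f unfolding borel_measurable_restrict_space_iff[OF S'] by (rule borel_measurable_AE[rotated])
qed

lemma L2_on_AE_cong:
  fixes f g :: "'a::euclidean_space \<Rightarrow> 'b::euclidean_space"
  assumes f: "f \<in> L2_on S" and S: "S \<in> sets lebesgue"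
    and eq: "AE x in lebesgue_on S. f x = g x"
  shows "g \<in> L2_on S"
proof -
  have g: "g \<in> borel_measurable (lebesgue_on S)"
    using borel_measurable_lebesgue_on_AE[OF L2_measurable[OF f] S eq] .
  have "integrable (lebesgue_on S) (\<lambda>x. (norm (g x))\<^sup>2)"
  proof (rule integrable_cong_AE_imp[OF L2_integrable[OF f]])
    show "AE x in lebesgue_on S. (norm (f x))\<^sup>2 = (norm (g x))\<^sup>2"
      using eq by eventually_elim simp
  qed (use g in measurable)
  then show ?thesis using g by (simp add: L2_def)
qed

lemma L2_on_continuous:
  fixes f :: "'a::euclidean_space \<Rightarrow> 'b::euclidean_space"
  assumes "compact S" and f: "continuous_on S f"
  shows "f \<in> L2_on S"
proof -
  have S: "S \<in> sets lebesgue" and S': "S \<inter> space lebesgue \<in> sets lebesgue"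
    using lmeasurable_compact[OF \<open>compact S\<close>] by (auto simp: fmeasurableD)
  have "integrable lborel (\<lambda>x. indicator S x *\<^sub>R (norm (f x))\<^sup>2)"
    using assms by (intro borel_integrable_compact continuous_intros)
  then have "integrable lebesgue (\<lambda>x. indicator S x *\<^sub>R (norm (f x))\<^sup>2)"
    using integrable_completion borel_measurable_integrable by blast
  then have "integrable (lebesgue_on S) (\<lambda>x. (norm (f x))\<^sup>2)"
    by (simp only: integrable_restrict_space[OF S'])
  then show ?thesis
    using continuous_imp_measurable_on_sets_lebesgue[OF f S] by (simp add: L2_def)
qed

text \<open>Since |y| \<le> 1 + |y|^2, finite measure of \<open>S\<close> gives an integrable
  majorant.\<close>

lemma integrable_lebesgue_on_L2:
  fixes f :: "'a::euclidean_space \<Rightarrow> 'b::euclidean_space"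
  assumes "f \<in> L2_on S" and "S \<in> lmeasurable"
  shows "integrable (lebesgue_on S) f"
proof (rule Bochner_Integration.integrable_bound)
  have S: "S \<in> sets lebesgue" "emeasure lebesgue S < \<infinity>"
    using assms(2) by (auto simp: fmeasurable_def)
  then have "finite_measure (lebesgue_on S)"
    by (auto intro!: finite_measureI simp: emeasure_restrict_space)
  then show "integrable (lebesgue_on S) (\<lambda>x. 1 + (norm (f x))\<^sup>2)"
    using L2_integrable[OF assms(1)]
    by (intro Bochner_Integration.integrable_add finite_measure.integrable_const) auto
  have "norm y \<le> 1 + (norm y)\<^sup>2" for y :: 'b
  proof -
    have "0 \<le> (norm y - 1)\<^sup>2" "0 \<le> norm y" by simp_all
    then show ?thesis unfolding power2_diff by (simp only: power_one mult_1_right)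
  qed
  then show "AE x in lebesgue_on S. norm (f x) \<le> norm (1 + (norm (f x))\<^sup>2)"
    by simp
qed (rule L2_measurable[OF assms(1)])

text \<open>More than restriction to a subset: a closed element can contain boundary points of the
  open \<Omega>, where nothing is known of \<open>f\<close>. Such points form a null set.\<close>

lemma L2_on_subset_ae:
  fixes f :: "'a::euclidean_space \<Rightarrow> 'b::euclidean_space"
  assumes f: "f \<in> L2_on T" and T: "T \<in> sets lebesgue" and S: "S \<in> sets lebesgue"
    and neg: "negligible (S - T)"
  shows "f \<in> L2_on S"
proof -
  have S': "S \<inter> space lebesgue \<in> sets lebesgue" and T': "T \<inter> space lebesgue \<in> sets lebesgue"
    using S T by simp_all
  have "S - T \<in> null_sets lebesgue"
    using neg by (simp add: negligible_iff_null_sets)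
  then have ae: "AE x in lebesgue. x \<notin> S - T"
    by (rule AE_not_in)
  have "(\<lambda>x. indicator T x *\<^sub>R f x) \<in> borel_measurable lebesgue"
    using L2_measurable[OF f] by (simp only: borel_measurable_restrict_space_iff[OF T'])
  then have "(\<lambda>x. indicator S x *\<^sub>R indicator T x *\<^sub>R f x) \<in> borel_measurable lebesgue"
    by (rule borel_measurable_scaleR[OF borel_measurable_indicator[OF S]])
  moreover have "AE x in lebesgue. indicator S x *\<^sub>R indicator T x *\<^sub>R f x = indicator S x *\<^sub>R f x"
    using ae by eventually_elim (auto simp: indicator_def)
  ultimately have "(\<lambda>x. indicator S x *\<^sub>R f x) \<in> borel_measurable lebesgue"
    by (rule borel_measurable_AE)
  then have m: "f \<in> borel_measurable (lebesgue_on S)"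
    by (simp only: borel_measurable_restrict_space_iff[OF S'])
  have "integrable lebesgue (\<lambda>x. indicator T x *\<^sub>R (norm (f x))\<^sup>2)"
    using L2_integrable[OF f] by (simp only: integrable_restrict_space[OF T'])
  then have "integrable lebesgue (\<lambda>x. indicator S x *\<^sub>R (norm (f x))\<^sup>2)"
  proof (rule Bochner_Integration.integrable_bound)
    show "AE x in lebesgue. norm (indicator S x *\<^sub>R (norm (f x))\<^sup>2) \<le> norm (indicator T x *\<^sub>R (norm (f x))\<^sup>2)"
      using ae by eventually_elim (auto simp: indicator_def)
    have "(\<lambda>x. (norm (f x))\<^sup>2) \<in> borel_measurable (lebesgue_on S)"
      using m by measurable
    then show "(\<lambda>x. indicator S x *\<^sub>R (norm (f x))\<^sup>2) \<in> borel_measurable lebesgue"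
      by (simp only: borel_measurable_restrict_space_iff[OF S'])
  qed
  then have "integrable (lebesgue_on S) (\<lambda>x. (norm (f x))\<^sup>2)"
    by (simp only: integrable_restrict_space[OF S'])
  with m show ?thesis by (simp add: L2_def)
qed

lemma integral_lebesgue_on_eq_lebesgue:
  fixes f :: "'a::euclidean_space \<Rightarrow> 'b::{banach, second_countable_topology}"
  assumes "S \<in> sets lebesgue" and "\<And>x. x \<notin> S \<Longrightarrow> f x = 0"
  shows "(\<integral>x. f x \<partial>lebesgue_on S) = (\<integral>x. f x \<partial>lebesgue)"
proof -
  have "(\<lambda>x. indicator S x *\<^sub>R f x) = f"
    using assms(2) by (auto simp: indicator_def)
  then show ?thesis
    using assms(1) by (subst integral_restrict_space) simp_all
qed

section \<open>Weak gradients and their uniqueness\<close>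

text \<open>The integrals split only if each product is integrable, which \<open>tests\<close>
  ensures; on compact \<open>D\<close> it is discharged by \<open>test_function_L2\<close>.\<close>

lemma has_weak_grad_diff:
  assumes v: "has_weak_grad D v g" and w: "has_weak_grad D w k"
    and tests: "\<And>\<phi>. \<phi> \<in> test_functions D \<Longrightarrow> \<phi> \<in> L2_on D \<and> classical_grad \<phi> \<in> L2_on D"
  shows "has_weak_grad D (\<lambda>x. v x - w x) (\<lambda>x. g x - k x)"
  unfolding has_weak_grad_def
proof (intro conjI ballI)
  fix \<phi> assume "\<phi> \<in> test_functions D"
  with v w tests show "(\<integral>x. (v x - w x) *\<^sub>R classical_grad \<phi> x \<partial>lebesgue_on D) =
      - (\<integral>x. \<phi> x *\<^sub>R (g x - k x) \<partial>lebesgue_on D)"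
    unfolding has_weak_grad_def
    by (simp add: scaleR_diff_left scaleR_diff_right integrable_L2_scaleR)
qed (use v w in \<open>simp_all add: has_weak_grad_def L2_diff\<close>)

lemma has_weak_grad_AE_cong:
  assumes v: "has_weak_grad D v g" and D: "D \<in> sets lebesgue"
    and eq: "AE x in lebesgue_on D. v x = w x"
    and tests: "\<And>\<phi>. \<phi> \<in> test_functions D \<Longrightarrow> classical_grad \<phi> \<in> L2_on D"
  shows "has_weak_grad D w g"
  unfolding has_weak_grad_def
proof (intro conjI ballI)
  have v2: "v \<in> L2_on D" using v by (simp add: has_weak_grad_def)
  show w2: "w \<in> L2_on D" by (rule L2_on_AE_cong[OF v2 D eq])
  show "g \<in> L2_on D" using v by (simp add: has_weak_grad_def)
  fix \<phi> assume \<phi>: "\<phi> \<in> test_functions D"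
  have "(\<integral>x. w x *\<^sub>R classical_grad \<phi> x \<partial>lebesgue_on D) =
      (\<integral>x. v x *\<^sub>R classical_grad \<phi> x \<partial>lebesgue_on D)"
  proof (rule integral_cong_AE)
    show "AE x in lebesgue_on D. w x *\<^sub>R classical_grad \<phi> x = v x *\<^sub>R classical_grad \<phi> x"
      using eq by eventually_elim simp
  qed (use v2 w2 tests[OF \<phi>] in \<open>simp_all add: borel_measurable_scaleR[OF L2_measurable L2_measurable]\<close>)
  then show "(\<integral>x. w x *\<^sub>R classical_grad \<phi> x \<partial>lebesgue_on D) =
      - (\<integral>x. \<phi> x *\<^sub>R g x \<partial>lebesgue_on D)"
    using v \<phi> by (simp add: has_weak_grad_def)
qed

section \<open>Regularity and support of test functions\<close>

lemma test_function_Ck: "\<phi> \<in> test_functions D \<Longrightarrow> Ck k \<phi>"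
  by (simp add: test_functions_def smooth_def)

lemma test_function_continuous:
  assumes "\<phi> \<in> test_functions D"
  shows "continuous_on S \<phi>"
proof (rule continuous_on_subset[OF _ subset_UNIV])
  show "continuous_on UNIV \<phi>"
    using test_function_Ck[OF assms, of 0] by simp
qed

lemma test_function_eq_0:
  assumes "\<phi> \<in> test_functions D" and "x \<notin> interior D"
  shows "\<phi> x = 0" "classical_grad \<phi> x = 0"
proof -
  have x: "x \<notin> closure {x. \<phi> x \<noteq> 0}"
    using assms by (auto simp: test_functions_def)
  then show "classical_grad \<phi> x = 0" by (rule classical_grad_eq_0)
  show "\<phi> x = 0" using x closure_subset[of "{x. \<phi> x \<noteq> 0}"] by auto
qed

lemma test_function_L2:
  assumes "compact D" "\<phi> \<in> test_functions D"
  shows "\<phi> \<in> L2_on D" "classical_grad \<phi> \<in> L2_on D"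
proof -
  show "\<phi> \<in> L2_on D"
    by (rule L2_on_continuous[OF assms(1) test_function_continuous[OF assms(2)]])
  show "classical_grad \<phi> \<in> L2_on D"
    by (intro L2_on_continuous[OF assms(1)] continuous_on_classical_grad test_function_Ck[OF assms(2)])
qed

text \<open>Testing with bumps that converge to the indicator of a box shows that the difference of two weak
  gradients has integral zero over every box inside \<open>D\<close>; differentiating over shrinking cubes gives
  the claim.\<close>

lemma has_weak_grad_unique:
  fixes v :: "real^'d \<Rightarrow> real"
  assumes g: "has_weak_grad D v g" and k: "has_weak_grad D v k"
    and D: "D \<in> lmeasurable" and neg: "negligible (D - interior D)"
  shows "AE x in lebesgue_on D. g x = k x"
proof -
  have Ds: "D \<in> sets lebesgue" and Ds': "D \<inter> space lebesgue \<in> sets lebesgue"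
    using D by (auto simp: fmeasurableD)
  \<comment> \<open>Extension by zero, because the differentiation theorem used below needs
    integrability over every box of the space.\<close>
  define f where "f x = indicator D x *\<^sub>R (g x - k x)" for x
  have gk: "integrable (lebesgue_on D) g" "integrable (lebesgue_on D) k"
    using g k by (auto simp: has_weak_grad_def intro: integrable_lebesgue_on_L2[OF _ D])
  then have gkd: "integrable (lebesgue_on D) (\<lambda>x. g x - k x)"
    by simp
  then have f: "integrable lebesgue f"
    unfolding f_def by (simp only: integrable_restrict_space[OF Ds'])
  have box0: "integral (cbox a b) f = 0" if ab: "cbox a b \<subseteq> interior D" for a b
  proof -
    let ?s = "\<lambda>n x. box_bump a b n x *\<^sub>R (g x - k x)"
    have bm: "box_bump a b n \<in> borel_measurable (lebesgue_on D)" for n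
      by (rule continuous_imp_measurable_on_sets_lebesgue[OF
            test_function_continuous[OF box_bump_test_function[OF ab]] Ds])
    have int: "integrable (lebesgue_on D) (\<lambda>x. box_bump a b n x *\<^sub>R h x)"
      if h: "integrable (lebesgue_on D) h" for n and h :: "real^'d \<Rightarrow> real^'d"
    proof (rule Bochner_Integration.integrable_bound[OF h])
      show "(\<lambda>x. box_bump a b n x *\<^sub>R h x) \<in> borel_measurable (lebesgue_on D)"
        by (rule borel_measurable_scaleR[OF bm borel_measurable_integrable[OF h]])
      show "AE x in lebesgue_on D. norm (box_bump a b n x *\<^sub>R h x) \<le> norm (h x)"
        by (simp add: box_bump_bounds mult_left_le_one_le)
    qed
    have "(\<integral>x. box_bump a b n x *\<^sub>R g x \<partial>lebesgue_on D) =
        (\<integral>x. box_bump a b n x *\<^sub>R k x \<partial>lebesgue_on D)" for n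
    proof -
      note t = box_bump_test_function[OF ab, of n]
      have "- (\<integral>x. box_bump a b n x *\<^sub>R g x \<partial>lebesgue_on D) =
          - (\<integral>x. box_bump a b n x *\<^sub>R k x \<partial>lebesgue_on D)"
        using bspec[OF conjunct2[OF conjunct2[OF g[unfolded has_weak_grad_def]]] t]
          bspec[OF conjunct2[OF conjunct2[OF k[unfolded has_weak_grad_def]]] t] by (rule trans[OF sym])
      then show ?thesis by simp
    qed
    then have z: "(\<integral>x. ?s n x \<partial>lebesgue_on D) = 0" for n
      using int gk by (simp add: scaleR_diff_right)
    have "(\<lambda>n. \<integral>x. ?s n x \<partial>lebesgue_on D) \<longlonglongrightarrow>
        (\<integral>x. indicator (box a b) x *\<^sub>R (g x - k x) \<partial>lebesgue_on D)"
    proof (rule integral_dominated_convergence)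
      show "integrable (lebesgue_on D) (\<lambda>x. norm (g x - k x))"
        using gkd by (rule integrable_norm)
      show "AE x in lebesgue_on D. (\<lambda>n. ?s n x) \<longlonglongrightarrow> indicator (box a b) x *\<^sub>R (g x - k x)"
        by (intro AE_I2 tendsto_scaleR box_bump_tendsto tendsto_const)
      show "AE x in lebesgue_on D. norm (?s n x) \<le> norm (g x - k x)" for n
        by (simp add: box_bump_bounds mult_left_le_one_le)
      show "?s n \<in> borel_measurable (lebesgue_on D)" for n
        by (rule borel_measurable_integrable[OF int[OF gkd]])
      have "indicator (box a b) \<in> borel_measurable lebesgue"
        by (rule borel_measurable_indicator) simp
      then show "(\<lambda>x. indicator (box a b) x *\<^sub>R (g x - k x)) \<in> borel_measurable (lebesgue_on D)"
        by (intro borel_measurable_scaleR borel_measurable_integrable[OF gkd] measurable_restrict_space1)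
    qed
    then have "(\<integral>x. indicator (box a b) x *\<^sub>R (g x - k x) \<partial>lebesgue_on D) = 0"
      unfolding z by (simp only: LIMSEQ_const_iff)
    moreover have "(\<integral>x. indicator (box a b) x *\<^sub>R (g x - k x) \<partial>lebesgue_on D) =
        (LINT x:box a b|lebesgue. f x)"
      unfolding integral_restrict_space[OF Ds'] set_lebesgue_integral_def f_def
      by (simp add: mult_ac)
    moreover have "set_integrable lebesgue (box a b) f"
      unfolding set_integrable_def
      by (rule integrable_mult_indicator[OF _ f]) simp
    ultimately have "integral (box a b) f = 0"
      using set_lebesgue_integral_eq_integral(2)[of "box a b" f] by simp
    \<comment> \<open>The bumps converge to the indicator of the open box, but averages are taken
      over closed ones; the faces are null.\<close>
    then show ?thesis by (simp add: integral_open_interval)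
  qed
  have "f integrable_on cbox a b" for a b
  proof -
    have "f absolutely_integrable_on UNIV"
      using f by (simp add: set_integrable_def)
    then show ?thesis
      by (rule integrable_on_subcbox[OF set_lebesgue_integral_eq_integral(1) subset_UNIV])
  qed
  \<comment> \<open>Lebesgue differentiation with cubes that have \<open>x\<close> as lower
    corner.\<close>
  from integrable_ccontinuous_explicit[OF this] obtain N where N: "negligible N"
    and lim: "\<And>x e. x \<notin> N \<Longrightarrow> 0 < e \<Longrightarrow> \<exists>d>0. \<forall>h. 0 < h \<and> h < d \<longrightarrow>
      norm (integral (cbox x (x + h *\<^sub>R One)) f /\<^sub>R h ^ DIM(real^'d) - f x) < e"
    by blast
  have f0: "f x = 0" if x: "x \<in> interior D" "x \<notin> N" for x
  proof (rule ccontr)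
    assume "f x \<noteq> 0"
    \<comment> \<open>With tolerance \<open>norm (f x)\<close>, one small cube of average 0 is
      already contradictory.\<close>
    then obtain d where "d > 0" and d: "\<And>h. 0 < h \<Longrightarrow> h < d \<Longrightarrow>
        norm (integral (cbox x (x + h *\<^sub>R One)) f /\<^sub>R h ^ DIM(real^'d) - f x) < norm (f x)"
      using lim[OF x(2), of "norm (f x)"] by auto
    obtain r where "r > 0" and r: "cball x r \<subseteq> interior D"
      using x(1) open_contains_cball open_interior by blast
    let ?One = "One :: real^'d"
    have One: "norm ?One > 0" by simp
    \<comment> \<open>\<open>d / 2\<close> makes \<open>h < d\<close> strict; the second bound keeps
      the diagonal, of length \<open>h * norm One\<close>, at most \<open>r\<close>, so the cube
      stays in the ball.\<close>
    define h where "h = min (d / 2) (r / norm ?One)"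
    have h: "0 < h" "h < d" "h * norm ?One \<le> r"
      using \<open>d > 0\<close> \<open>r > 0\<close> One by (auto simp: h_def min_def field_simps)
    have "cbox x (x + h *\<^sub>R One) \<subseteq> cball x r"
    proof
      fix y assume y: "y \<in> cbox x (x + h *\<^sub>R One)"
      have "norm (y - x) \<le> norm (h *\<^sub>R ?One)"
      proof (rule norm_le_componentwise)
        fix b :: "real^'d" assume b: "b \<in> Basis"
        then have "x \<bullet> b \<le> y \<bullet> b \<and> y \<bullet> b \<le> x \<bullet> b + (h *\<^sub>R ?One) \<bullet> b"
          using y by (simp add: mem_box inner_add_left)
        then show "\<bar>(y - x) \<bullet> b\<bar> \<le> \<bar>(h *\<^sub>R ?One) \<bullet> b\<bar>"
          by (simp add: inner_diff_left)
      qed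
      then show "y \<in> cball x r"
        using h by (simp add: dist_norm norm_minus_commute)
    qed
    then have "integral (cbox x (x + h *\<^sub>R One)) f = 0"
      using r by (intro box0) auto
    then show False using d[OF h(1,2)] by simp
  qed
  have "N \<union> (D - interior D) \<in> null_sets lebesgue"
    using N neg by (simp add: negligible_iff_null_sets[symmetric])
  then have "AE x in lebesgue. x \<notin> N \<union> (D - interior D)"
    by (rule AE_not_in)
  then have "AE x in lebesgue. x \<in> D \<longrightarrow> g x = k x"
    by eventually_elim (use f0 in \<open>auto simp: f_def indicator_def\<close>)
  then show ?thesis by (simp only: AE_restrict_space_iff[OF Ds'])
qed

section \<open>Weak gradients of polynomials and restriction to elements\<close>

lemma integrable_compact_support:
  fixes f :: "'a::euclidean_space \<Rightarrow> 'b::{banach, second_countable_topology}"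
  assumes "continuous_on UNIV f" and "compact S" and "\<And>x. x \<notin> S \<Longrightarrow> f x = 0"
  shows "integrable lborel f"
proof -
  have "(\<lambda>x. indicator S x *\<^sub>R f x) = f"
    using assms(3) by (auto simp: indicator_def)
  then show ?thesis
    using borel_integrable_compact[OF assms(2) continuous_on_subset[OF assms(1) subset_UNIV]] by simp
qed

lemma lborel_integral_translate:
  fixes f :: "'a::euclidean_space \<Rightarrow> 'b::{banach, second_countable_topology}"
  assumes "f \<in> borel_measurable borel"
  shows "(\<integral>x. f (c + x) \<partial>lborel) = (\<integral>x. f x \<partial>lborel)"
proof -
  have "(\<integral>x. f x \<partial>lborel) = (\<integral>x. f x \<partial>distr lborel borel ((+) c))"
    by (simp only: lborel_distr_plus)
  also have "\<dots> = (\<integral>x. f (c + x) \<partial>lborel)"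
    by (rule integral_distr) (use assms in simp_all)
  finally show ?thesis by (rule sym)
qed

text \<open>By translation invariance, the difference quotients of \<open>F\<close> have integral zero.\<close>

lemma integral_partial_derivative_eq_0:
  fixes F :: "real^'d \<Rightarrow> real"
  assumes F: "Ck (Suc 0) F" and S: "compact S" and supp: "\<And>x. x \<notin> S \<Longrightarrow> F x = 0"
  shows "(\<integral>x. classical_grad F x $ i \<partial>lborel) = 0"
proof -
  define e where "e = (axis i 1 :: real^'d)"
  define G where "G x = classical_grad F x $ i" for x
  have ne: "norm e = 1" by (simp add: e_def)
  have contF: "continuous_on UNIV F" using Ck_SucD[OF F] by simp
  have contG: "continuous_on UNIV G" using F by (simp add: G_def[abs_def])
  have "{x. F x \<noteq> 0} \<subseteq> S" using supp by auto
  then have clS: "closure {x. F x \<noteq> 0} \<subseteq> S"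
    using closure_minimal compact_imp_closed[OF S] by blast
  have G0: "G x = 0" if "x \<notin> S" for x
  proof -
    have "classical_grad F x = 0"
      by (rule classical_grad_eq_0) (use that clS in blast)
    then show ?thesis by (simp add: G_def)
  qed
  have "compact (G ` S)"
    using compact_continuous_image[OF continuous_on_subset[OF contG subset_UNIV] S] .
  then obtain B where B: "\<And>x. x \<in> S \<Longrightarrow> norm (G x) \<le> B" and "B > 0"
    using compact_imp_bounded bounded_pos by (metis imageI)
  have GB: "\<bar>G x\<bar> \<le> B" for x
    using B[of x] G0[of x] \<open>B > 0\<close> by (cases "x \<in> S") auto
  obtain R where R: "\<And>x. x \<in> S \<Longrightarrow> norm x \<le> R"
    using compact_imp_bounded[OF S] bounded_iff by blast
  have deriv: "((\<lambda>t. F (t *\<^sub>R e + x)) has_real_derivative G (t *\<^sub>R e + x)) (at t)" for t x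
  proof -
    have "((\<lambda>t. t *\<^sub>R e + x) has_derivative (\<lambda>h. h *\<^sub>R e)) (at t)"
      by (auto intro!: derivative_eq_intros)
    from has_derivative_compose[OF this Ck_has_derivative(1)[OF F]]
    have "((\<lambda>t. F (t *\<^sub>R e + x)) has_derivative
        (\<lambda>h. frechet_derivative F (at (t *\<^sub>R e + x)) (h *\<^sub>R e))) (at t)" .
    moreover have "(\<lambda>h. frechet_derivative F (at (t *\<^sub>R e + x)) (h *\<^sub>R e)) = (*) (G (t *\<^sub>R e + x))"
      using linear_frechet_derivative[of F "at (t *\<^sub>R e + x)"] F
      by (auto simp: G_def classical_grad_def e_def linear_scale)
    ultimately show ?thesis by (simp add: has_field_derivative_def)
  qed
  define \<tau> where "\<tau> n = 1 / real (Suc n)" for n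
  have \<tau>: "0 < \<tau> n" "\<tau> n \<le> 1" for n by (auto simp: \<tau>_def)
  have \<tau>0: "\<tau> \<longlonglongrightarrow> 0"
    unfolding \<tau>_def using LIMSEQ_inverse_real_of_nat by (simp add: inverse_eq_divide)
  define s where "s n x = (F (\<tau> n *\<^sub>R e + x) - F x) / \<tau> n" for n x
  have contS: "continuous_on UNIV (\<lambda>x. F (c + x))" for c
    by (rule continuous_on_compose2[OF contF]) (auto intro!: continuous_intros)
  have mF: "F \<in> borel_measurable borel" using contF by (rule borel_measurable_continuous_onI)
  have intF: "integrable lborel F"
    by (rule integrable_compact_support[OF contF S supp])
  have intS: "integrable lborel (\<lambda>x. F (c + x))" for c
  proof (rule integrable_compact_support[OF contS])
    show "compact ((\<lambda>x. - c + x) ` S)"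
      by (rule compact_translation[OF S])
    show "F (c + x) = 0" if "x \<notin> (\<lambda>x. - c + x) ` S" for x
      using that by (intro supp) force
  qed
  have s0: "(\<integral>x. s n x \<partial>lborel) = 0" for n
    unfolding s_def using intF intS lborel_integral_translate[OF mF] by simp
  have "(\<lambda>n. \<integral>x. s n x \<partial>lborel) \<longlonglongrightarrow> (\<integral>x. G x \<partial>lborel)"
  proof (rule integral_dominated_convergence)
    show "G \<in> borel_measurable lborel"
      using borel_measurable_continuous_onI[OF contG] by simp
    show "s n \<in> borel_measurable lborel" for n
      unfolding s_def using intS intF
      by (intro borel_measurable_divide borel_measurable_diff borel_measurable_integrable) auto
    \<comment> \<open>Majorant for the difference quotients: \<open>B\<close> bounds them by the
      mean value theorem. The radius is \<open>R + 1\<close> because \<open>S\<close> lies within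
      \<open>R\<close> of the origin and the shifts have length \<tau> n \<le> 1.\<close>
    show "integrable lborel (\<lambda>x. indicator (cball 0 (R + 1)) x *\<^sub>R B)"
      by (rule borel_integrable_compact) auto
    show "AE x in lborel. (\<lambda>n. s n x) \<longlonglongrightarrow> G x"
    proof (rule AE_I2)
      fix x
      have "((\<lambda>h. (F (h *\<^sub>R e + x) - F x) / h) \<longlongrightarrow> G x) (at 0)"
        using deriv[of x 0] by (simp add: DERIV_def)
      moreover have "filterlim \<tau> (at 0) sequentially"
        using \<tau>0 \<tau>(1) by (auto simp: filterlim_at intro!: always_eventually) (metis less_irrefl)
      ultimately show "(\<lambda>n. s n x) \<longlonglongrightarrow> G x"
        unfolding s_def by (rule filterlim_compose)
    qed
    show "AE x in lborel. norm (s n x) \<le> indicator (cball 0 (R + 1)) x *\<^sub>R B" for n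
    proof (rule AE_I2)
      fix x
      show "norm (s n x) \<le> indicator (cball 0 (R + 1)) x *\<^sub>R B"
      proof (cases "x \<in> cball 0 (R + 1)")
        case True
        obtain z where "F (\<tau> n *\<^sub>R e + x) - F (0 *\<^sub>R e + x) = (\<tau> n - 0) * G (z *\<^sub>R e + x)"
          using MVT2[of 0 "\<tau> n" "\<lambda>t. F (t *\<^sub>R e + x)" "\<lambda>t. G (t *\<^sub>R e + x)"] \<tau>(1) deriv by blast
        then have "s n x = G (z *\<^sub>R e + x)"
          using \<tau>(1)[of n] by (simp add: s_def)
        then show ?thesis using True GB by simp
      next
        case False
        have "norm x \<le> norm (\<tau> n *\<^sub>R e + x) + norm (\<tau> n *\<^sub>R e)"
          using norm_triangle_ineq4[of "\<tau> n *\<^sub>R e + x" "\<tau> n *\<^sub>R e"] by simp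
        also have "norm (\<tau> n *\<^sub>R e) \<le> 1"
          using \<tau>[of n] by (simp add: ne)
        finally have "norm (\<tau> n *\<^sub>R e + x) > R"
          using False by simp
        moreover have "norm x > R" using False by simp
        ultimately have "F (\<tau> n *\<^sub>R e + x) = 0" "F x = 0"
          using R supp by (meson not_less)+
        then show ?thesis using False by (simp add: s_def)
      qed
    qed
  qed
  then show ?thesis
    unfolding s0 by (simp only: LIMSEQ_const_iff G_def)
qed

lemma integral_vec_nth:
  fixes f :: "'a \<Rightarrow> real^'d"
  assumes "integrable M f"
  shows "(\<integral>x. f x \<partial>M) $ i = (\<integral>x. f x $ i \<partial>M)"
  using integral_bounded_linear[OF bounded_linear_vec_nth assms] by simp

text \<open>The product of \<open>P\<close> with a test function is C^1 and vanishes off the compact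
  \<open>D\<close>, so its gradient integrates to zero; the product rule turns this into integration
  by parts, with no boundary term.\<close>

lemma has_weak_grad_classical:
  fixes P :: "real^'d \<Rightarrow> real"
  assumes D: "compact D" and P: "Ck (Suc 0) P"
  shows "has_weak_grad D P (classical_grad P)"
  unfolding has_weak_grad_def
proof (intro conjI ballI)
  have Ds: "D \<in> sets lebesgue" using lmeasurable_compact[OF D] by (rule fmeasurableD)
  have contP: "continuous_on S P" for S
    by (rule continuous_on_subset[OF _ subset_UNIV]) (use Ck_SucD[OF P] in simp)
  show "P \<in> L2_on D" by (rule L2_on_continuous[OF D contP])
  show "classical_grad P \<in> L2_on D"
    by (rule L2_on_continuous[OF D continuous_on_classical_grad[OF P]])
  fix \<phi> assume \<phi>: "\<phi> \<in> test_functions D"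
  note C\<phi> = test_function_Ck[OF \<phi>, of "Suc 0"]
  have out: "\<phi> x = 0" "classical_grad \<phi> x = 0" if "x \<notin> D" for x
    using test_function_eq_0[OF \<phi>, of x] that interior_subset by auto
  define F where "F x = P x * \<phi> x" for x
  have F: "Ck (Suc 0) F" unfolding F_def by (rule Ck_mult[OF P C\<phi>])
  have gradF: "classical_grad F x = P x *\<^sub>R classical_grad \<phi> x + \<phi> x *\<^sub>R classical_grad P x" for x
    unfolding F_def by (rule classical_grad_mult) (use P C\<phi> in auto)
  have int: "integrable lborel (\<lambda>x. P x *\<^sub>R classical_grad \<phi> x)"
      "integrable lborel (\<lambda>x. \<phi> x *\<^sub>R classical_grad P x)"
    by (intro integrable_compact_support[OF _ D] continuous_on_scaleR contP
        continuous_on_classical_grad P C\<phi> test_function_continuous[OF \<phi>], simp add: out)+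
  have "(\<integral>x. classical_grad F x \<partial>lborel) = 0"
  proof (rule vec_eq_iff[THEN iffD2], rule allI)
    fix i
    have "integrable lborel (classical_grad F)"
      unfolding gradF using int by simp
    then have "(\<integral>x. classical_grad F x \<partial>lborel) $ i = (\<integral>x. classical_grad F x $ i \<partial>lborel)"
      by (rule integral_vec_nth)
    also have "\<dots> = 0"
      by (rule integral_partial_derivative_eq_0[OF F D]) (simp add: F_def out)
    finally show "(\<integral>x. classical_grad F x \<partial>lborel) $ i = 0 $ i" by simp
  qed
  then have "(\<integral>x. P x *\<^sub>R classical_grad \<phi> x \<partial>lborel) = - (\<integral>x. \<phi> x *\<^sub>R classical_grad P x \<partial>lborel)"
    unfolding gradF using int by (simp add: eq_neg_iff_add_eq_0)
  moreover have "(\<integral>x. f x \<partial>lebesgue_on D) = (\<integral>x. f x \<partial>lborel)"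
    if "\<And>x. x \<notin> D \<Longrightarrow> f x = 0" "integrable lborel f" for f :: "real^'d \<Rightarrow> real^'d"
    using integral_lebesgue_on_eq_lebesgue[OF Ds that(1)]
      integral_completion[OF borel_measurable_integrable[OF that(2)]] by simp
  ultimately show "(\<integral>x. P x *\<^sub>R classical_grad \<phi> x \<partial>lebesgue_on D) =
      - (\<integral>x. \<phi> x *\<^sub>R classical_grad P x \<partial>lebesgue_on D)"
    using int by (simp add: out)
qed

text \<open>A test function on \<open>K\<close> is supported in \<open>interior K\<close>, hence is
  one on \<Omega>, and both integrands vanish off the intersection of \<open>K\<close> and \<Omega>.
  The same \<open>g\<close> therefore serves on \<open>K\<close>.\<close>

lemma has_weak_grad_subset:
  assumes v: "has_weak_grad \<Omega> v g" and \<Omega>: "open \<Omega>"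
    and K: "K \<in> sets lebesgue" "interior K \<subseteq> \<Omega>" "negligible (K - interior K)"
  shows "has_weak_grad K v g"
  unfolding has_weak_grad_def
proof (intro conjI ballI)
  have \<Omega>s: "\<Omega> \<in> sets lebesgue" using \<Omega> by simp
  have neg: "negligible (K - \<Omega>)"
    by (rule negligible_subset[OF K(3)]) (use K(2) in auto)
  show "v \<in> L2_on K" "g \<in> L2_on K"
    using v L2_on_subset_ae[OF _ \<Omega>s K(1) neg] by (auto simp: has_weak_grad_def)
  fix \<phi> assume \<phi>: "\<phi> \<in> test_functions K"
  have \<phi>\<Omega>: "\<phi> \<in> test_functions \<Omega>"
    using \<phi> K(2) interior_open[OF \<Omega>] by (auto simp: test_functions_def)
  have out: "\<phi> x = 0" "classical_grad \<phi> x = 0" if "x \<notin> K \<or> x \<notin> \<Omega>" for x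
  proof -
    have "x \<notin> interior K" using that K(2) interior_subset by blast
    then show "\<phi> x = 0" "classical_grad \<phi> x = 0" by (rule test_function_eq_0[OF \<phi>])+
  qed
  have "(\<integral>x. f x \<partial>lebesgue_on K) = (\<integral>x. f x \<partial>lebesgue_on \<Omega>)"
    if "\<And>x. x \<notin> K \<or> x \<notin> \<Omega> \<Longrightarrow> f x = 0" for f :: "real^'a \<Rightarrow> real^'a"
    using integral_lebesgue_on_eq_lebesgue[OF K(1), of f] integral_lebesgue_on_eq_lebesgue[OF \<Omega>s, of f] that
    by simp
  then show "(\<integral>x. v x *\<^sub>R classical_grad \<phi> x \<partial>lebesgue_on K) = - (\<integral>x. \<phi> x *\<^sub>R g x \<partial>lebesgue_on K)"
    using v \<phi>\<Omega> by (simp add: has_weak_grad_def out)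
qed

text \<open>Every neighbourhood of a boundary point contains points strictly below the local graph.
  These have a neighbourhood free of \<Omega>, so the boundary point is not interior to the
  closure.\<close>

lemma interior_closure_lipschitz_domain:
  assumes "lipschitz_domain \<Omega>"
  shows "interior (closure \<Omega>) = \<Omega>"
proof
  have "open \<Omega>" using assms by (simp add: lipschitz_domain_def)
  then show "\<Omega> \<subseteq> interior (closure \<Omega>)"
    by (simp add: closure_subset interior_maximal)
  show "interior (closure \<Omega>) \<subseteq> \<Omega>"
  proof (rule subsetI, rule ccontr)
    fix x assume x: "x \<in> interior (closure \<Omega>)" and "x \<notin> \<Omega>"
    then have "x \<in> frontier \<Omega>"
      using interior_subset interior_open[OF \<open>open \<Omega>\<close>] by (auto simp: frontier_def)
    with assms have "\<exists>r>0. \<exists>e L. \<exists>\<phi> :: real^'a \<Rightarrow> real. norm e = 1 \<and> lipschitz_on L UNIV \<phi> \<and>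
        \<Omega> \<inter> ball x r = {y \<in> ball x r. \<phi> (y - (y \<bullet> e) *\<^sub>R e) < y \<bullet> e}"
      unfolding lipschitz_domain_def by blast
    then obtain r e L and \<phi> :: "real^'a \<Rightarrow> real"
      where "r > 0" and e: "norm e = 1" and L: "L-lipschitz_on UNIV \<phi>"
        and graph: "\<Omega> \<inter> ball x r = {y \<in> ball x r. \<phi> (y - (y \<bullet> e) *\<^sub>R e) < y \<bullet> e}"
      by blast
    define U where "U = {y. y \<bullet> e < \<phi> (y - (y \<bullet> e) *\<^sub>R e)}"
    have "continuous_on UNIV (\<lambda>y. \<phi> (y - (y \<bullet> e) *\<^sub>R e))"
      by (rule continuous_on_compose2[OF lipschitz_on_continuous_on[OF L]])
        (auto intro!: continuous_intros)
    then have "open U"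
      unfolding U_def by (intro open_Collect_less continuous_intros)
    have ee: "e \<bullet> e = 1" using e by (simp add: norm_eq_1)
    have "\<not> \<phi> (x - (x \<bullet> e) *\<^sub>R e) < x \<bullet> e"
    proof
      assume "\<phi> (x - (x \<bullet> e) *\<^sub>R e) < x \<bullet> e"
      then have "x \<in> \<Omega> \<inter> ball x r" unfolding graph using \<open>r > 0\<close> by simp
      with \<open>x \<notin> \<Omega>\<close> show False by simp
    qed
    \<comment> \<open>Moving against \<open>e\<close> keeps the orthogonal component, hence the
      value of \<phi>, and strictly lowers the height.\<close>
    then have below: "x - t *\<^sub>R e \<in> U" if "t > 0" for t
      using that by (simp add: U_def inner_diff_left ee scaleR_diff_left)
    obtain s where "s > 0" and s: "ball x s \<subseteq> closure \<Omega>"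
      using x by (auto simp: mem_interior)
    \<comment> \<open>Below \<open>r\<close> to remain in the ball where the graph describes
      \<Omega>, below \<open>s\<close> to remain in the closure.\<close>
    define t where "t = min r s / 2"
    have t: "0 < t" "t < r" "t < s" using \<open>r > 0\<close> \<open>s > 0\<close> by (auto simp: t_def)
    have "x - t *\<^sub>R e \<in> closure \<Omega>"
      using t e by (intro subsetD[OF s]) (simp add: dist_norm)
    moreover have "x - t *\<^sub>R e \<in> U \<inter> ball x r"
      using t e below by (simp add: dist_norm)
    moreover have "open (U \<inter> ball x r)" using \<open>open U\<close> by auto
    ultimately have "\<Omega> \<inter> (U \<inter> ball x r) \<noteq> {}"
      using open_Int_closure_eq_empty[of "U \<inter> ball x r" \<Omega>] by blast
    then obtain y where y: "y \<in> \<Omega> \<inter> ball x r" "y \<in> U" by blast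
    then show False unfolding graph by (simp add: U_def)
  qed
qed

section \<open>The discrete dual norm and the local estimate\<close>

lemma AE_lebesgue_on_subset_ae:
  assumes ae: "AE x in lebesgue_on T. P x" and T: "T \<in> sets lebesgue" and S: "S \<in> sets lebesgue"
    and neg: "negligible (S - T)"
  shows "AE x in lebesgue_on S. P x"
proof -
  have S': "S \<inter> space lebesgue \<in> sets lebesgue" and T': "T \<inter> space lebesgue \<in> sets lebesgue"
    using S T by simp_all
  have "S - T \<in> null_sets lebesgue"
    using neg by (simp add: negligible_iff_null_sets)
  then have "AE x in lebesgue. x \<notin> S - T"
    by (rule AE_not_in)
  moreover have "AE x in lebesgue. x \<in> T \<longrightarrow> P x"
    using ae by (simp only: AE_restrict_space_iff[OF T'])
  ultimately have "AE x in lebesgue. x \<in> S \<longrightarrow> P x"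
    by eventually_elim auto
  then show ?thesis by (simp only: AE_restrict_space_iff[OF S'])
qed

lemma has_weak_grad_grad: "has_weak_grad D v g \<Longrightarrow> has_weak_grad D v (grad D v)"
  unfolding grad_def by (rule someI[where P = "has_weak_grad D v"])

lemma V_loc_has_weak_grad:
  assumes K: "compact K" and v: "v \<in> V_loc K r"
  shows "has_weak_grad K v (grad K v)"
proof -
  from v obtain P where P: "P \<in> polys r" and eq: "AE x in lebesgue_on K. v x = P x"
    by (auto simp: V_loc_def)
  have "K \<in> sets lebesgue" using lmeasurable_compact[OF K] by (rule fmeasurableD)
  moreover have "AE x in lebesgue_on K. P x = v x"
    using eq by eventually_elim simp
  ultimately have "has_weak_grad K v (classical_grad P)"
    by (rule has_weak_grad_AE_cong[OF has_weak_grad_classical[OF K Ck_polys[OF P]]])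
      (rule test_function_L2(2)[OF K])
  then show ?thesis by (rule has_weak_grad_grad)
qed

lemma V_star_locD: "v \<in> V_star_loc K r \<Longrightarrow> v \<in> V_loc K r"
  by (simp add: V_star_loc_def)

lemma has_weak_grad_L2: "has_weak_grad D v g \<Longrightarrow> g \<in> L2_on D"
  by (simp add: has_weak_grad_def)

text \<open>The way to compute with the choice operator \<open>grad\<close>: any explicit weak
  gradient may stand in for it under the integral.\<close>

lemma grad_AE_eq:
  assumes "has_weak_grad D v g" and "D \<in> lmeasurable" and "negligible (D - interior D)"
  shows "AE x in lebesgue_on D. grad D v x = g x"
  using has_weak_grad_unique[OF has_weak_grad_grad[OF assms(1)] assms(1)] assms(2,3) .

lemma has_weak_grad_zero: "has_weak_grad D (\<lambda>x. 0) (\<lambda>x. 0)"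
  by (simp add: has_weak_grad_def L2_def)

lemma has_weak_grad_minus:
  assumes "compact D" and "has_weak_grad D v g"
  shows "has_weak_grad D (\<lambda>x. - v x) (\<lambda>x. - g x)"
  using has_weak_grad_diff[OF has_weak_grad_zero assms(2)] test_function_L2[OF assms(1)] by simp

section \<open>Polynomial spaces and a nonzero polynomial of mean zero\<close>

lemma finite_multi_indices: "finite {\<alpha> :: 'd::finite \<Rightarrow> nat. sum \<alpha> UNIV \<le> r}"
proof (rule finite_subset)
  show "finite ((UNIV :: 'd set) \<rightarrow>\<^sub>E {..r})" by (simp add: finite_PiE)
  show "{\<alpha> :: 'd \<Rightarrow> nat. sum \<alpha> UNIV \<le> r} \<subseteq> UNIV \<rightarrow>\<^sub>E {..r}"
  proof
    fix \<alpha> :: "'d \<Rightarrow> nat" assume "\<alpha> \<in> {\<alpha>. sum \<alpha> UNIV \<le> r}"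
    then have "\<alpha> i \<le> r" for i
      using member_le_sum[of i UNIV \<alpha>] by (simp add: order_trans)
    then show "\<alpha> \<in> UNIV \<rightarrow>\<^sub>E {..r}" by (auto simp: PiE_UNIV_domain)
  qed
qed

lemma coordinate_in_polys:
  fixes i :: "'d::finite"
  assumes "1 \<le> r"
  shows "(\<lambda>x. x $ i - c) \<in> polys r"
proof -
  let ?A = "{\<alpha> :: 'd \<Rightarrow> nat. sum \<alpha> UNIV \<le> r}"
  \<comment> \<open>\<delta> and \<open>z\<close> are the exponents of the monomials
    \<open>x $ i\<close> and 1.\<close>
  define \<delta> where "\<delta> = (\<lambda>j. if j = i then 1 else 0 :: nat)"
  define z where "z = (\<lambda>j::'d. 0 :: nat)"
  define co where "co \<alpha> = (if \<alpha> = \<delta> then 1 else if \<alpha> = z then - c else 0)" for \<alpha>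
  have ne: "\<delta> \<noteq> z" by (auto simp: \<delta>_def z_def fun_eq_iff)
  have A: "\<delta> \<in> ?A" "z \<in> ?A" using assms by (simp_all add: \<delta>_def z_def)
  have "x $ i - c = (\<Sum>\<alpha>\<in>?A. co \<alpha> * (\<Prod>j\<in>UNIV. x $ j ^ \<alpha> j))" for x :: "real^'d"
  proof -
    have "(\<Sum>\<alpha>\<in>?A. co \<alpha> * (\<Prod>j\<in>UNIV. x $ j ^ \<alpha> j)) = (\<Sum>\<alpha>\<in>{\<delta>, z}. co \<alpha> * (\<Prod>j\<in>UNIV. x $ j ^ \<alpha> j))"
      using A by (intro sum.mono_neutral_right finite_multi_indices) (auto simp: co_def)
    also have "\<dots> = (\<Prod>j\<in>UNIV. x $ j ^ \<delta> j) - c"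
      using ne by (simp add: co_def z_def)
    also have "(\<Prod>j\<in>UNIV. x $ j ^ \<delta> j) = (\<Prod>j\<in>UNIV. if j = i then x $ j else 1)"
      by (intro prod.cong) (auto simp: \<delta>_def)
    also have "\<dots> = x $ i" by simp
    finally show ?thesis by simp
  qed
  then show ?thesis unfolding polys_def by blast
qed

lemma polys_minus:
  assumes "P \<in> polys r"
  shows "(\<lambda>x. - P x) \<in> polys r"
proof -
  from assms obtain c where
    c: "\<And>x. P x = (\<Sum>\<alpha>\<in>{\<alpha>. sum \<alpha> UNIV \<le> r}. c \<alpha> * (\<Prod>i\<in>UNIV. x $ i ^ \<alpha> i))"
    unfolding polys_def by blast
  then have "- P x = (\<Sum>\<alpha>\<in>{\<alpha>. sum \<alpha> UNIV \<le> r}. - c \<alpha> * (\<Prod>i\<in>UNIV. x $ i ^ \<alpha> i))" for x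
    by (simp add: sum_negf)
  then show ?thesis unfolding polys_def mem_Collect_eq by (intro exI[of _ "\<lambda>\<alpha>. - c \<alpha>"]) simp
qed

lemma V_star_loc_minus:
  assumes "v \<in> V_star_loc K r"
  shows "(\<lambda>x. - v x) \<in> V_star_loc K r"
proof -
  from assms obtain P where P: "P \<in> polys r" "AE x in lebesgue_on K. v x = P x"
    and mean: "inner_on K v (\<lambda>x. 1) = 0"
    by (auto simp: V_star_loc_def V_loc_def)
  have "(\<lambda>x. - v x) \<in> V_loc K r"
    using polys_minus[OF P(1)] P(2) by (auto simp: V_loc_def intro!: bexI[of _ "\<lambda>x. - P x"])
  then show ?thesis
    using mean l2_inner_scaleR_left[of "lebesgue_on K" "- 1" v] by (simp add: V_star_loc_def)
qed

text \<open>A coordinate minus its mean over \<open>K\<close> works: it vanishes only on a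
  hyperplane, a null set, while nonempty interior gives \<open>K\<close> positive measure.\<close>

lemma V_star_loc_nontrivial:
  fixes K :: "(real^'d) set"
  assumes K: "compact K" and int: "interior K \<noteq> {}" and "1 \<le> r"
  obtains v where "v \<in> V_star_loc K r" "\<not> (AE x in lebesgue_on K. v x = 0)"
proof -
  have Km: "K \<in> lmeasurable" by (rule lmeasurable_compact[OF K])
  have Ks: "K \<inter> space lebesgue \<in> sets lebesgue" using Km by (simp add: fmeasurableD)
  have nneg: "\<not> negligible K"
    using open_not_negligible[OF open_interior int] negligible_subset interior_subset by blast
  then have pos: "measure lebesgue K \<noteq> 0"
    using Km negligible_iff_measure by blast
  fix i :: 'd
  define c where "c = (\<integral>x. x $ i \<partial>lebesgue_on K) / measure lebesgue K"
  define v where "v x = x $ i - c" for x :: "real^'d"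
  have i: "integrable (lebesgue_on K) (\<lambda>x. x $ i)"
    by (intro integrable_lebesgue_on_L2[OF L2_on_continuous[OF K] Km] continuous_intros)
  have one: "integrable (lebesgue_on K) (\<lambda>x. c)"
    by (intro integrable_lebesgue_on_L2[OF L2_on_continuous[OF K] Km] continuous_intros)
  have "(\<integral>x. c \<partial>lebesgue_on K) = c * measure lebesgue K"
    using Ks by (simp add: measure_restrict_space)
  then have "inner_on K v (\<lambda>x. 1) = 0"
    using i one pos by (simp add: l2_inner_def v_def c_def)
  moreover have "v \<in> V_loc K r"
    using coordinate_in_polys[OF \<open>1 \<le> r\<close>, of i c]
    by (auto simp: V_loc_def v_def intro!: bexI[of _ "\<lambda>x. x $ i - c"])
  moreover have "\<not> (AE x in lebesgue_on K. v x = 0)"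
  proof
    assume "AE x in lebesgue_on K. v x = 0"
    then have "AE x in lebesgue. x \<in> K \<longrightarrow> v x = 0"
      by (simp only: AE_restrict_space_iff[OF Ks])
    then obtain N where N: "N \<in> null_sets lebesgue" "{x. \<not> (x \<in> K \<longrightarrow> v x = 0)} \<subseteq> N"
      by (auto simp: eventually_ae_filter)
    have "K \<subseteq> N \<union> {x. axis i 1 \<bullet> x = c}"
      using N(2) by (auto simp: v_def inner_axis')
    moreover have "negligible (N \<union> {x. axis i 1 \<bullet> x = c})"
      using N(1) by (intro negligible_Un negligible_hyperplane) (auto simp: negligible_iff_null_sets axis_eq_0_iff)
    ultimately show False using nneg negligible_subset by blast
  qed
  ultimately show thesis by (intro that) (auto simp: V_star_loc_def)
qed

text \<open>The quotients are bounded by \<open>norm_on K q\<close> through Cauchy-Schwarz, so the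
  real \<open>Sup\<close> dominates them. A vanishing denominator makes the quotient 0 by
  convention.\<close>

lemma dual_norm_upper:
  assumes K: "compact K" and q: "q \<in> L2_on K"
    and v: "v \<in> V_star_loc K (p + 2)" "\<not> (AE x in lebesgue_on K. v x = 0)"
  shows "inner_on K q (grad K v) / norm_on K (grad K v) \<le> dual_norm p K q"
  unfolding dual_norm_def
proof (rule cSup_upper)
  show "bdd_above {inner_on K q (grad K v) / norm_on K (grad K v) | v.
      v \<in> V_star_loc K (p + 2) \<and> \<not> (AE x in lebesgue_on K. v x = 0)}"
  proof (rule bdd_aboveI, clarify)
    fix w assume "w \<in> V_star_loc K (p + 2)"
    then have "grad K w \<in> L2_on K"
      by (rule has_weak_grad_L2[OF V_loc_has_weak_grad[OF K V_star_locD]])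
    then have "inner_on K q (grad K w) \<le> norm_on K q * norm_on K (grad K w)"
      using l2_cauchy_schwarz[OF q] abs_le_D1 by blast
    then show "inner_on K q (grad K w) / norm_on K (grad K w) \<le> norm_on K q"
      using l2_norm_nonneg[of "lebesgue_on K" "grad K w"] l2_norm_nonneg[of "lebesgue_on K" q]
      by (cases "norm_on K (grad K w) = 0") (simp_all add: divide_le_eq)
  qed
qed (use v in blast)

text \<open>This needs a nonzero test function, since \<open>Sup {}\<close> is unspecified on the reals.\<close>

lemma dual_norm_nonneg:
  assumes K: "compact K" "negligible (K - interior K)" "interior K \<noteq> {}" and q: "q \<in> L2_on K"
  shows "0 \<le> dual_norm p K q"
proof -
  obtain v where v: "v \<in> V_star_loc K (p + 2)" "\<not> (AE x in lebesgue_on K. v x = 0)"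
    using V_star_loc_nontrivial[OF K(1,3), of "p + 2"] by auto
  \<comment> \<open>\<open>v\<close> and its negative are both admissible with opposite quotients,
    so the supremum dominates a number and its negative.\<close>
  let ?w = "\<lambda>x. - v x"
  have w: "?w \<in> V_star_loc K (p + 2)" "\<not> (AE x in lebesgue_on K. ?w x = 0)"
    using V_star_loc_minus[OF v(1)] v(2) by simp_all
  have gv: "has_weak_grad K v (grad K v)"
    by (rule V_loc_has_weak_grad[OF K(1) V_star_locD[OF v(1)]])
  have gw: "AE x in lebesgue_on K. grad K ?w x = - grad K v x"
    by (rule grad_AE_eq[OF has_weak_grad_minus[OF K(1) gv] lmeasurable_compact[OF K(1)] K(2)])
  have L2v: "grad K v \<in> L2_on K" and L2w: "grad K ?w \<in> L2_on K" and L2m: "(\<lambda>x. - grad K v x) \<in> L2_on K"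
    using has_weak_grad_minus[OF K(1) gv] has_weak_grad_grad gv has_weak_grad_L2 by blast+
  have "inner_on K q (grad K ?w) = inner_on K q (\<lambda>x. - grad K v x)"
    by (rule l2_inner_cong_AE[OF q L2w q L2m _ gw]) simp
  also have "\<dots> = - inner_on K q (grad K v)"
    by (simp add: l2_inner_def)
  finally have i: "inner_on K q (grad K ?w) = - inner_on K q (grad K v)" .
  have "inner_on K (grad K ?w) (grad K ?w) = inner_on K (\<lambda>x. - grad K v x) (\<lambda>x. - grad K v x)"
    by (rule l2_inner_cong_AE[OF L2w L2w L2m L2m gw gw])
  then have "norm_on K (grad K ?w) = norm_on K (grad K v)"
    by (simp add: l2_norm_def l2_inner_def)
  with i dual_norm_upper[OF K(1) q v] dual_norm_upper[OF K(1) q w] show ?thesis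
    by simp
qed

text \<open>Multiplies out the quotient. A zero gradient norm is covered by Cauchy-Schwarz; a
  positive one makes \<open>v\<close> admissible in the supremum, since a function vanishing almost
  everywhere has zero weak gradient.\<close>

lemma inner_on_grad_le_dual_norm:
  fixes K :: "(real^'d) set"
  assumes K: "compact K" "negligible (K - interior K)" "interior K \<noteq> {}" and q: "q \<in> L2_on K"
    and v: "v \<in> V_star_loc K (p + 2)"
  shows "inner_on K q (grad K v) \<le> dual_norm p K q * norm_on K (grad K v)"
proof -
  have gv: "has_weak_grad K v (grad K v)"
    by (rule V_loc_has_weak_grad[OF K(1) V_star_locD[OF v]])
  note L2v = has_weak_grad_L2[OF gv]
  consider "norm_on K (grad K v) = 0" | "norm_on K (grad K v) > 0"
    using l2_norm_nonneg[of "lebesgue_on K" "grad K v"] by linarith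
  then show ?thesis
  proof cases
    case 1
    then show ?thesis using l2_cauchy_schwarz[OF q L2v] by simp
  next
    case 2
    have "\<not> (AE x in lebesgue_on K. v x = 0)"
    proof
      assume ae: "AE x in lebesgue_on K. v x = 0"
      have Ks: "K \<in> sets lebesgue" using lmeasurable_compact[OF K(1)] by (rule fmeasurableD)
      have "AE x in lebesgue_on K. 0 = v x"
        using ae by eventually_elim simp
      from has_weak_grad_AE_cong[OF has_weak_grad_zero Ks this test_function_L2(2)[OF K(1)]]
      have zero: "has_weak_grad K v (\<lambda>x. 0)" .
      have "inner_on K (grad K v) (grad K v) = inner_on K (\<lambda>x. 0 :: real^'d) (\<lambda>x. 0)"
        by (intro l2_inner_cong_AE L2v has_weak_grad_L2[OF zero]
            grad_AE_eq[OF zero lmeasurable_compact[OF K(1)] K(2)])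
      then show False using 2 by (simp add: l2_norm_def l2_inner_def)
    qed
    from dual_norm_upper[OF K(1) q v this] 2 show ?thesis
      by (simp add: divide_le_eq)
  qed
qed

section \<open>Geometry of one element and the estimate on it\<close>

lemma simplex_full_dim:
  fixes K :: "(real^'d) set"
  assumes "int CARD('d) simplex K"
  shows "compact K" "negligible (K - interior K)" "interior K \<noteq> {}"
proof -
  show "compact K" by (rule compact_simplex[OF assms])
  have "convex K" by (rule convex_simplex[OF assms])
  have "K - interior K \<subseteq> frontier K"
    using closure_subset by (auto simp: frontier_def)
  then show "negligible (K - interior K)"
    using negligible_convex_frontier[OF \<open>convex K\<close>] negligible_subset by blast
  have "aff_dim K = int (DIM(real^'d))"
    using aff_dim_simplex[OF assms] by simp
  then have "affine hull K = UNIV" by (simp only: aff_dim_eq_full)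
  \<comment> \<open>The empty set has affine dimension -1.\<close>
  moreover from \<open>aff_dim K = _\<close> have "K \<noteq> {}" by auto
  ultimately show "interior K \<noteq> {}"
    using \<open>convex K\<close> rel_interior_interior rel_interior_eq_empty by metis
qed

lemma local_estimate:
  fixes K :: "(real^'d) set"
  assumes K: "compact K" "negligible (K - interior K)" "interior K \<noteq> {}"
    and u: "has_weak_grad K u g" and q: "q \<in> L2_on K" "AE x in lebesgue_on K. q x = - g x"
    and qh: "q\<^sub>h \<in> L2_on K"
    and \<epsilon>: "\<epsilon> \<in> V_star_loc K (p + 2)" and \<nu>: "\<nu> \<in> V_loc K r"
    and eq: "inner_on K (grad K \<epsilon>) (grad K \<epsilon>) + inner_on K (grad K \<nu>) (grad K \<epsilon>)
        = - inner_on K q\<^sub>h (grad K \<epsilon>)"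
  shows "norm_on K (grad K \<epsilon>)
      \<le> norm_on K (grad K (\<lambda>x. u x - \<nu> x)) + dual_norm p K (\<lambda>x. q x - q\<^sub>h x)"
proof -
  define N where "N = norm_on K (grad K \<epsilon>)"
  define G where "G = grad K (\<lambda>x. u x - \<nu> x)"
  have Km: "K \<in> lmeasurable" by (rule lmeasurable_compact[OF K(1)])
  have w\<nu>: "has_weak_grad K \<nu> (grad K \<nu>)" by (rule V_loc_has_weak_grad[OF K(1) \<nu>])
  have w\<epsilon>: "has_weak_grad K \<epsilon> (grad K \<epsilon>)"
    by (rule V_loc_has_weak_grad[OF K(1) V_star_locD[OF \<epsilon>]])
  have wG: "has_weak_grad K (\<lambda>x. u x - \<nu> x) (\<lambda>x. g x - grad K \<nu> x)"
    by (intro has_weak_grad_diff[OF u w\<nu>] conjI test_function_L2[OF K(1)])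
  note L2 = has_weak_grad_L2[OF u] has_weak_grad_L2[OF w\<nu>] has_weak_grad_L2[OF w\<epsilon>]
    has_weak_grad_L2[OF has_weak_grad_grad[OF wG], folded G_def] has_weak_grad_L2[OF wG]
  have mg: "(\<lambda>x. - g x) \<in> L2_on K"
    using L2_scaleR[OF L2(1), of "- 1"] by simp
  have 1: "inner_on K G (grad K \<epsilon>) = inner_on K g (grad K \<epsilon>) - inner_on K (grad K \<nu>) (grad K \<epsilon>)"
  proof -
    have "inner_on K G (grad K \<epsilon>) = inner_on K (\<lambda>x. g x - grad K \<nu> x) (grad K \<epsilon>)"
      unfolding G_def
      by (rule l2_inner_cong_AE[OF L2(4)[unfolded G_def] L2(3) L2(5) L2(3) grad_AE_eq[OF wG Km K(2)]]) simp
    then show ?thesis by (simp only: l2_inner_diff_left[OF L2(1,2,3)])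
  qed
  have 2: "inner_on K (\<lambda>x. q x - q\<^sub>h x) (grad K \<epsilon>) = - inner_on K g (grad K \<epsilon>) - inner_on K q\<^sub>h (grad K \<epsilon>)"
  proof -
    have "inner_on K q (grad K \<epsilon>) = inner_on K (\<lambda>x. - g x) (grad K \<epsilon>)"
      by (rule l2_inner_cong_AE[OF q(1) L2(3) mg L2(3) q(2)]) simp
    then show ?thesis
      using l2_inner_scaleR_left[of "lebesgue_on K" "- 1" g]
      by (simp add: l2_inner_diff_left[OF q(1) qh L2(3)])
  qed
  \<comment> \<open>In the sum of \<open>1\<close> and \<open>2\<close> the terms with
    \<open>g\<close> cancel, leaving the tested equation \<open>eq\<close>.\<close>
  have "N * N = inner_on K G (grad K \<epsilon>) + inner_on K (\<lambda>x. q x - q\<^sub>h x) (grad K \<epsilon>)"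
    using eq 1 2 by (simp add: N_def l2_norm_sq)
  also have "\<dots> \<le> norm_on K G * N + dual_norm p K (\<lambda>x. q x - q\<^sub>h x) * N"
    using l2_cauchy_schwarz[OF L2(4,3)] inner_on_grad_le_dual_norm[OF K L2_diff[OF q(1) qh] \<epsilon>]
    by (simp add: N_def)
  finally have "N * N \<le> (norm_on K G + dual_norm p K (\<lambda>x. q x - q\<^sub>h x)) * N"
    by (simp add: distrib_right)
  moreover have "0 \<le> N" "0 \<le> norm_on K G"
    unfolding N_def by (rule l2_norm_nonneg)+
  moreover have "0 \<le> dual_norm p K (\<lambda>x. q x - q\<^sub>h x)"
    by (rule dual_norm_nonneg[OF K L2_diff[OF q(1) qh]])
  ultimately have "N \<le> norm_on K G + dual_norm p K (\<lambda>x. q x - q\<^sub>h x)"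
    by (cases "N = 0") simp_all
  then show ?thesis by (simp only: N_def G_def)
qed

theorem theorem3p10:
  fixes \<Omega> :: "(real^'d) set"
    and mesh :: "real \<Rightarrow> (real^'d) set set"
    and p :: nat
    and h :: real
    and f u\<^sub>D u u\<^sub>h \<epsilon>\<^sub>h \<nu>\<^sub>h :: "real^'d \<Rightarrow> real"
    and q q\<^sub>h :: "real^'d \<Rightarrow> real^'d"
  assumes "CARD('d) = 2 \<or> CARD('d) = 3"
    and "polyhedral_lipschitz_domain \<Omega>"
    and "shape_regular_mesh_family \<Omega> mesh"
    and "p \<ge> 1"
    and "f \<in> L2_on \<Omega>"
    and "u\<^sub>D \<in> H_half \<Omega>"
    and "model_solution \<Omega> f u\<^sub>D u q"
    and "h > 0"
    and "mfem_solution \<Omega> (mesh h) p f u\<^sub>D u\<^sub>h q\<^sub>h"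
    and "sp_solution \<Omega> (mesh h) p u\<^sub>h q\<^sub>h \<epsilon>\<^sub>h \<nu>\<^sub>h"
  shows "\<forall>K\<in>mesh h.
           estimator K \<epsilon>\<^sub>h
             \<le> norm_on K (grad K (\<lambda>x. u x - \<nu>\<^sub>h x)) + dual_norm p K (\<lambda>x. q x - q\<^sub>h x)"
proof
  fix K assume K: "K \<in> mesh h"
  have lip: "lipschitz_domain \<Omega>"
    using assms(2) by (simp add: polyhedral_lipschitz_domain_def)
  then have \<Omega>: "open \<Omega>" by (simp add: lipschitz_domain_def)
  then have \<Omega>s: "\<Omega> \<in> sets lebesgue" by simp
  have cm: "conforming_mesh \<Omega> (mesh h)"
    using assms(3,8) by (simp add: shape_regular_mesh_family_def)
  then have "int CARD('d) simplex K" and KU: "K \<subseteq> closure \<Omega>"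
    using K by (auto simp: conforming_mesh_def)
  note Kp = simplex_full_dim[OF this(1)]
  have Ks: "K \<in> sets lebesgue" using lmeasurable_compact[OF Kp(1)] by (rule fmeasurableD)
  \<comment> \<open>Here the Lipschitz condition enters: monotonicity alone gives only the interior
    of the closure.\<close>
  have int: "interior K \<subseteq> \<Omega>"
    using interior_mono[OF KU] interior_closure_lipschitz_domain[OF lip] by simp
  have neg: "negligible (K - \<Omega>)"
    by (rule negligible_subset[OF Kp(2)]) (use int in auto)
  have q: "q \<in> L2_on \<Omega>" and qg: "AE x in lebesgue_on \<Omega>. q x = - grad \<Omega> u x" and u: "u \<in> H1 \<Omega>"
    using assms(7) by (auto simp: model_solution_def Hdiv_def has_weak_div_def)
  have qh: "q\<^sub>h \<in> L2_on \<Omega>"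
    using assms(9) by (auto simp: mfem_solution_def H_mesh_def Hdiv_def has_weak_div_def)
  \<comment> \<open>On \<open>K\<close> the weak gradient of \<open>u\<close> is taken to be
    \<open>grad \<Omega> u\<close> rather than \<open>grad K u\<close>, so that it matches the
    equation for \<open>q\<close>.\<close>
  have wu: "has_weak_grad \<Omega> u (grad \<Omega> u)"
    using u has_weak_grad_grad by (auto simp: H1_def)
  have \<epsilon>: "\<epsilon>\<^sub>h \<in> V_star_loc K (p + 2)" and \<nu>: "\<nu>\<^sub>h \<in> V_loc K (p + 1)"
    using assms(10) K by (simp_all add: sp_solution_def V_star_mesh_def V_mesh_def)
  have eq: "inner_on K (grad K \<epsilon>\<^sub>h) (grad K \<epsilon>\<^sub>h) + inner_on K (grad K \<nu>\<^sub>h) (grad K \<epsilon>\<^sub>h)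
      = - inner_on K q\<^sub>h (grad K \<epsilon>\<^sub>h)"
    using assms(10) K \<epsilon> by (simp add: sp_solution_def)
  show "estimator K \<epsilon>\<^sub>h
      \<le> norm_on K (grad K (\<lambda>x. u x - \<nu>\<^sub>h x)) + dual_norm p K (\<lambda>x. q x - q\<^sub>h x)"
    unfolding estimator_def
    by (rule local_estimate[OF Kp has_weak_grad_subset[OF wu \<Omega> Ks int Kp(2)]
          L2_on_subset_ae[OF q \<Omega>s Ks neg] AE_lebesgue_on_subset_ae[OF qg \<Omega>s Ks neg]
          L2_on_subset_ae[OF qh \<Omega>s Ks neg] \<epsilon> \<nu> eq])
qed

end
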